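(* Let $J\in\mathbb{N}$, let $\mu_1,\dots,\mu_J>0$, $0<\lambda<\infty$, a price set $\mathcal{A}\subset\mathbb{R}_+$ and a reservation-price distribution function $F$ be given with $\lambda\sum_{j=1}^J 1/\mu_j<1$ and $1-F(a-)>0$ for all $a\in\mathcal{A}$. Let $a^\pi\in\mathcal{A}$, let $\pi$ be the static policy that quotes the price $a^\pi$ in every state, and put $\lambda^\pi:=\lambda(1-F(a^\pi-))$. Then there are constants $c>0$ and $0<p<1$, depending only on $\lambda^\pi$ and $\mu_1,\dots,\mu_J$, such that for any $B_2,\dots,B_J\in\mathbb{Z}_+$ and all sufficiently large $B_1$, the gain of the tandem queueing system $(B_1,\dots,B_J)$ under $\pi$ satisfies $$g^{\pi}(B_1,B_2,\dots,B_J)\;\ge\; a^\pi\lambda(1-F(a^\pi-))\,(1-c\,p^{B_1-1})\;=\;a^\pi\lambda^\pi(1-c\,p^{B_1-1}).$$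
   Context: Notation: $\mathbb{Z}_+=\{0,1,2,\dots\}$, $[n]=\{0,1,\dots,n\}$, $f(a-)=\lim_{x\uparrow a}f(x)$, and $\mathbf{e}_j$ is the $j$-th standard unit vector of $\mathbb{R}^J$. Tandem queueing system $(B_1,\dots,B_J)\in\mathbb{Z}_+^J$: $J$ single-server first-come first-served stations in series; station $j$ has a buffer of size $B_j$, so it holds at most $B_j+1$ customers including the one in service; service times at station $j$ are exponential with rate $\mu_j$, all independent. Customers arrive at station 1 as a Poisson process of rate $\lambda$ and have i.i.d. reservation prices with cumulative distribution function $F$. An arriving customer enters if and only if station 1 is not full and the quoted price is at most her reservation price (so if price $a$ is quoted and station 1 is not full she enters with probability $1-F(a-)$); otherwise she is lost. A customer who enters visits stations $1,\dots,J$ in order and then leaves. Communication blocking: the server at station $j$ may not start service while station $j+1$ is full. State space: $\mathcal{S}=[B_1+1]\times\cdots\times[B_J+1]$, where $s_j$ is the number of customers at station $j$. A pricing policy is a function $\pi:\mathcal{S}\to\mathcal{A}$, $\pi(\mathbf{s})$ being the price quoted in state $\mathbf{s}$; it is static if it is constant. Under $\pi$ the state process $\{\mathbf{X}^\pi(t)\}_{t\ge 0}$ is the continuous-time Markov chain on $\mathcal{S}$ whose transition rates from $\mathbf{s}$ to $\mathbf{s}'\in\mathcal{S}$, $\mathbf{s}'\ne\mathbf{s}$, are: $\lambda(1-F(\pi(\mathbf{s})-))$ if $\mathbf{s}'=\mathbf{s}+\mathbf{e}_1$; $\mu_j$ if $\mathbf{s}'=\mathbf{s}-\mathbf{e}_j+\mathbf{e}_{j+1}$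 with $1\le j\le J-1$; $\mu_J$ if $\mathbf{s}'=\mathbf{s}-\mathbf{e}_J$; and $0$ otherwise. Gain: let $R^\pi(\mathbf{s},\mathbf{s}')=\pi(\mathbf{s})$ if $\mathbf{s}'=\mathbf{s}+\mathbf{e}_1$ and $0$ otherwise; let $T^\pi_0=0$ and let $T_1^\pi<T_2^\pi<\cdots$ be the successive jump times of $\mathbf{X}^\pi$. The gain (long-run expected time-average revenue) is $$g^\pi(B_1,\dots,B_J):=\lim_{T\to\infty}\frac1T\,\mathbb{E}\Big[\sum_{n\ge1:\,T_n^\pi\le T}R^\pi\big(\mathbf{X}^\pi(T^\pi_{n-1}),\mathbf{X}^\pi(T^\pi_n)\big)\Big],$$ which exists and does not depend on the initial state. *)

theory Defs
  imports "HOL-Probability.Probability"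
begin

text \<open>
  A process is a family \<open>X t \<omega>\<close>, \<open>t \<ge> 0\<close>. Its successive jump times are read off the path; a path
  that never jumps again repeats its last jump time (for the chains below, which have no absorbing
  states, this is a null event).
\<close>

fun jump_time :: "(real \<Rightarrow> 'w \<Rightarrow> 's) \<Rightarrow> nat \<Rightarrow> 'w \<Rightarrow> real" where
  "jump_time X 0 \<omega> = 0"
| "jump_time X (Suc n) \<omega> =
     (let t = jump_time X n \<omega>; A = {u. t < u \<and> X u \<omega> \<noteq> X t \<omega>} in if A = {} then t else Inf A)"

definition jump_chain :: "(real \<Rightarrow> 'w \<Rightarrow> 's) \<Rightarrow> nat \<Rightarrow> 'w \<Rightarrow> 's" where
  "jump_chain X n \<omega> = X (jump_time X n \<omega>) \<omega>"

definition holding_time :: "(real \<Rightarrow> 'w \<Rightarrow> 's) \<Rightarrow> nat \<Rightarrow> 'w \<Rightarrow> real" where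
  "holding_time X n \<omega> = jump_time X (Suc n) \<omega> - jump_time X n \<omega>"

definition exit_rate :: "'s set \<Rightarrow> ('s \<Rightarrow> 's \<Rightarrow> real) \<Rightarrow> 's \<Rightarrow> real" where
  "exit_rate S q s = (\<Sum>s' \<in> S - {s}. q s s')"

definition jump_prob :: "'s set \<Rightarrow> ('s \<Rightarrow> 's \<Rightarrow> real) \<Rightarrow> 's \<Rightarrow> 's \<Rightarrow> real" where
  "jump_prob S q s s' = (if s' = s then 0 else q s s' / exit_rate S q s)"

text \<open>
  Continuous-time Markov chain on the finite set \<open>S\<close> with transition rates \<open>q s s'\<close>
  (\<open>s \<noteq> s'\<close>), all exit rates positive, started in \<open>s0\<close>: a right-continuous process whose jump
  chain is a Markov chain with the transition probabilities \<open>jump_prob\<close> and whose holding times,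
  given the jump chain, are independent and exponential with the exit rates of the visited states.
  The last conjunct is the joint law of the first \<open>n\<close> jumps and holding times.
  See \<open>ctmc_exists\<close> for existence.
\<close>

definition ctmc ::
  "'w measure \<Rightarrow> (real \<Rightarrow> 'w \<Rightarrow> 's) \<Rightarrow> 's set \<Rightarrow> ('s \<Rightarrow> 's \<Rightarrow> real) \<Rightarrow> 's \<Rightarrow> bool" where
  "ctmc M X S q s0 \<longleftrightarrow>
     prob_space M \<and>
     (\<forall>t\<ge>0. X t \<in> M \<rightarrow>\<^sub>M count_space S) \<and>
     (\<forall>\<omega>\<in>space M. \<forall>t\<ge>0. \<forall>\<^sub>F u in at_right t. X u \<omega> = X t \<omega>) \<and>
     (\<forall>n. jump_chain X n \<in> M \<rightarrow>\<^sub>M count_space S) \<and>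
     (\<forall>n. holding_time X n \<in> borel_measurable M) \<and>
     (\<forall>n y t. (\<forall>i\<le>n. y i \<in> S) \<longrightarrow> (\<forall>i<n. 0 \<le> t i) \<longrightarrow>
        measure M {\<omega> \<in> space M. (\<forall>i\<le>n. jump_chain X i \<omega> = y i) \<and> (\<forall>i<n. t i < holding_time X i \<omega>)} =
        (if y 0 = s0
         then \<Prod>i<n. jump_prob S q (y i) (y (Suc i)) * exp (- exit_rate S q (y i) * t i)
         else 0))"

text \<open>
  Stations are numbered \<open>1, \<dots>, J\<close>; a state assigns to each station its number of customers
  (and is \<open>undefined\<close> at all other indices).
\<close>

type_synonym state = "nat \<Rightarrow> nat"

definition tandem_states :: "nat \<Rightarrow> (nat \<Rightarrow> nat) \<Rightarrow> state set" where
  "tandem_states J B = (\<Pi>\<^sub>E j\<in>{1..J}. {0..B j + 1})"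

definition left_lim :: "(real \<Rightarrow> real) \<Rightarrow> real \<Rightarrow> real" where
  "left_lim F a = Lim (at_left a) F"

definition arrive :: "state \<Rightarrow> state" where
  "arrive s = s(1 := s 1 + 1)"

definition move :: "nat \<Rightarrow> state \<Rightarrow> state" where
  "move j s = s(j := s j - 1, Suc j := s (Suc j) + 1)"

definition depart :: "nat \<Rightarrow> state \<Rightarrow> state" where
  "depart J s = s(J := s J - 1)"

text \<open>
  The possible targets of a transition out of \<open>s\<close> are pairwise different and different from \<open>s\<close>,
  so at most one summand is nonzero. Full buffers (lost customers, blocked servers) are accounted
  for by \<open>s' \<in> tandem_states J B\<close>; the guards \<open>0 < s j\<close> are needed because subtraction truncates.
\<close>

definition tandem_rate ::
  "nat \<Rightarrow> (nat \<Rightarrow> nat) \<Rightarrow> real \<Rightarrow> (nat \<Rightarrow> real) \<Rightarrow> (real \<Rightarrow> real) \<Rightarrow> (state \<Rightarrow> real) \<Rightarrow>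
     state \<Rightarrow> state \<Rightarrow> real" where
  "tandem_rate J B lam \<mu> F \<pi> s s' =
     (if s \<in> tandem_states J B \<and> s' \<in> tandem_states J B then
        (if s' = arrive s then lam * (1 - left_lim F (\<pi> s)) else 0) +
        (\<Sum>j=1..<J. if 0 < s j \<and> s' = move j s then \<mu> j else 0) +
        (if 0 < s J \<and> s' = depart J s then \<mu> J else 0)
      else 0)"

definition revenue :: "(state \<Rightarrow> real) \<Rightarrow> state \<Rightarrow> state \<Rightarrow> real" where
  "revenue \<pi> s s' = (if s' = arrive s then \<pi> s else 0)"

definition gain :: "'w measure \<Rightarrow> (real \<Rightarrow> 'w \<Rightarrow> state) \<Rightarrow> (state \<Rightarrow> real) \<Rightarrow> real" where
  "gain M X \<pi> =
     Lim at_top (\<lambda>T::real. 1 / T *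
       (\<integral>\<omega>. (\<Sum>n\<in>{n. 1 \<le> n \<and> jump_time X n \<omega> \<le> T}.
          revenue \<pi> (X (jump_time X (n - 1) \<omega>) \<omega>) (X (jump_time X n \<omega>) \<omega>)) \<partial>M))"

text \<open>The path that visits \<open>y 0, y 1, \<dots>\<close> with holding times \<open>h 0, h 1, \<dots>\<close>.\<close>

definition step_path :: "(nat \<Rightarrow> 's) \<Rightarrow> (nat \<Rightarrow> real) \<Rightarrow> real \<Rightarrow> 's" where
  "step_path y h t = (if \<exists>n. t < sum h {..<Suc n} then y (LEAST n. t < sum h {..<Suc n}) else y 0)"

context
  fixes y :: "nat \<Rightarrow> 's" and h :: "nat \<Rightarrow> real"
  assumes y: "\<And>n. y (Suc n) \<noteq> y n" and h: "\<And>n. 0 < h n"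
begin

lemma step_path_mono: "m \<le> n \<Longrightarrow> sum h {..<m} \<le> sum h {..<n}"
  by (rule sum_mono2) (auto simp: less_imp_le[OF h])

lemma step_path_eq:
  assumes "sum h {..<n} \<le> t" "t < sum h {..<Suc n}"
  shows "step_path y h t = y n"
proof -
  have "(LEAST n. t < sum h {..<Suc n}) = n"
  proof (rule Least_equality)
    fix m assume m: "t < sum h {..<Suc m}"
    show "n \<le> m"
    proof (rule ccontr)
      assume "\<not> n \<le> m"
      then have "sum h {..<Suc m} \<le> sum h {..<n}" by (intro step_path_mono) auto
      with m assms show False by linarith
    qed
  qed (fact assms)
  then show ?thesis using assms by (auto simp: step_path_def)
qed

lemma step_path_right_cont:
  assumes "0 \<le> t"
  shows "\<forall>\<^sub>F u in at_right t. step_path y h u = step_path y h t"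
proof (cases "\<exists>n. t < sum h {..<Suc n}")
  case True
  define n where "n = (LEAST n. t < sum h {..<Suc n})"
  have n: "t < sum h {..<Suc n}" unfolding n_def using True by (rule LeastI_ex)
  have n': "sum h {..<n} \<le> t"
  proof (cases n)
    case (Suc m)
    then have "m < (LEAST n. t < sum h {..<Suc n})" by (simp only: n_def lessI)
    then have "\<not> t < sum h {..<Suc m}" by (rule not_less_Least)
    then show ?thesis unfolding Suc by (simp only: not_less)
  qed (use assms in simp)
  have "\<forall>\<^sub>F u in at_right t. u < sum h {..<Suc n}"
    using n by (intro eventually_at_rightI[of t "sum h {..<Suc n}"]) auto
  moreover have "\<forall>\<^sub>F u in at_right t. t < u"
    by (rule eventually_at_right_less)
  ultimately show ?thesis
  proof eventually_elim
    case (elim u)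
    then have "step_path y h u = y n" "step_path y h t = y n"
      using n n' by (auto intro!: step_path_eq simp del: sum.lessThan_Suc)
    then show ?case by simp
  qed
next
  case False
  have "\<forall>\<^sub>F u in at_right t. t < u"
    by (rule eventually_at_right_less)
  then show ?thesis
  proof eventually_elim
    case (elim u)
    have "\<not> u < sum h {..<Suc n}" for n
      using False[unfolded not_ex, rule_format, of n] elim by linarith
    then have "\<nexists>n. u < sum h {..<Suc n}" by blast
    then show ?case using False by (simp only: step_path_def if_False)
  qed
qed

lemma jump_time_step_path:
  assumes X: "\<And>t. X t \<omega> = step_path y h t"
  shows "jump_time X n \<omega> = sum h {..<n}"
proof (induction n)
  case (Suc n)
  let ?T = "\<lambda>n. sum h {..<n}"
  have X1: "X (?T n) \<omega> = y n" for n unfolding X using h[of n] by (intro step_path_eq) auto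
  have "Inf {u. ?T n < u \<and> X u \<omega> \<noteq> X (?T n) \<omega>} = ?T (Suc n)"
  proof (rule cInf_eq_minimum)
    show "?T (Suc n) \<in> {u. ?T n < u \<and> X u \<omega> \<noteq> X (?T n) \<omega>}"
      using h[of n] y[of n] X1[of n] X1[of "Suc n"] by simp
    fix u assume u: "u \<in> {u. ?T n < u \<and> X u \<omega> \<noteq> X (?T n) \<omega>}"
    show "?T (Suc n) \<le> u"
    proof (rule ccontr)
      assume "\<not> ?T (Suc n) \<le> u"
      then have "X u \<omega> = y n" unfolding X using u by (intro step_path_eq) auto
      with u X1[of n] show False by simp
    qed
  qed
  moreover have "?T (Suc n) \<in> {u. ?T n < u \<and> X u \<omega> \<noteq> X (?T n) \<omega>}"
    using h[of n] y[of n] X1[of n] X1[of "Suc n"] by simp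
  ultimately show ?case unfolding jump_time.simps Let_def Suc by (metis empty_iff)
qed simp

lemma jump_chain_step_path:
  assumes X: "\<And>t. X t \<omega> = step_path y h t"
  shows "jump_chain X n \<omega> = y n"
  using jump_time_step_path[of X \<omega> n] X step_path_eq[of n "sum h {..<n}"] h[of n]
  by (simp add: jump_chain_def)

lemma holding_time_step_path:
  assumes X: "\<And>t. X t \<omega> = step_path y h t"
  shows "holding_time X n \<omega> = h n"
  using jump_time_step_path[of X \<omega> n] jump_time_step_path[of X \<omega> "Suc n"] X
  by (simp add: holding_time_def del: jump_time.simps)

end

lemma step_path_in:
  assumes "\<And>n. y n \<in> S"
  shows "step_path y h t \<in> S"
  using assms by (simp add: step_path_def)

lemma measurable_step_path:
  fixes y :: "nat \<Rightarrow> 'w \<Rightarrow> 's" and h :: "nat \<Rightarrow> 'w \<Rightarrow> real"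
  assumes "\<And>n. y n \<in> M \<rightarrow>\<^sub>M count_space S" and [measurable]: "\<And>n. h n \<in> borel_measurable M"
  shows "(\<lambda>\<omega>. step_path (\<lambda>n. y n \<omega>) (\<lambda>n. h n \<omega>) t) \<in> M \<rightarrow>\<^sub>M count_space S"
proof -
  define N where "N \<omega> = (LEAST n. t < sum (\<lambda>n. h n \<omega>) {..<Suc n})" for \<omega>
  have N: "N \<in> M \<rightarrow>\<^sub>M count_space UNIV" unfolding N_def by measurable
  have 1: "(\<lambda>\<omega>. y (N \<omega>) \<omega>) \<in> M \<rightarrow>\<^sub>M count_space S"
    by (rule measurable_compose_countable'[where I = UNIV, OF assms(1) N]) simp
  have 2: "Measurable.pred M (\<lambda>\<omega>. \<exists>n. t < sum (\<lambda>n. h n \<omega>) {..<Suc n})" by measurable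
  have "(\<lambda>\<omega>. if \<exists>n. t < sum (\<lambda>n. h n \<omega>) {..<Suc n} then y (N \<omega>) \<omega> else y 0 \<omega>) \<in> M \<rightarrow>\<^sub>M count_space S"
    using 1 assms(1)[of 0] 2 by (rule measurable_If[OF _ _ predE])
  then show ?thesis unfolding step_path_def N_def .
qed

text \<open>
  The chain is driven by independent pairs indexed by \<open>(n, s)\<close>, the next state and the holding
  time to be used if the \<open>n\<close>-th state visited is \<open>s\<close>.
\<close>

theorem ctmc_exists:
  fixes S :: "'s set" and q :: "'s \<Rightarrow> 's \<Rightarrow> real"
  assumes S: "finite S" and q: "\<And>s s'. s \<in> S \<Longrightarrow> s' \<in> S \<Longrightarrow> s \<noteq> s' \<Longrightarrow> 0 \<le> q s s'"
    and r: "\<And>s. s \<in> S \<Longrightarrow> 0 < exit_rate S q s" and s0: "s0 \<in> S"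
  shows "\<exists>(M :: (nat \<times> 's \<Rightarrow> 's \<times> real) measure) X. ctmc M X S q s0"
proof -
  define r' where "r' s = (if s \<in> S then exit_rate S q s else 1)" for s
  define K where "K s = (if s \<in> S then embed_pmf (\<lambda>s'. if s' \<in> S then jump_prob S q s s' else 0)
    else return_pmf s)" for s
  define d where "d s = (SOME x. x \<in> S - {s})" for s
  define nx where "nx s x = (if x \<in> S - {s} then x else d s)" for s x
  define ho where "ho u = (if (0::real) < u then u else 1)" for u
  define E where "E s = density lborel (exponential_density (r' s))" for s
  define N where "N s = measure_pmf (K s) \<Otimes>\<^sub>M E s" for s
  define M where "M = PiM (UNIV :: (nat \<times> 's) set) (\<lambda>(n, s). N s)"
  have r': "0 < r' s" for s using r by (simp add: r'_def)
  have E: "prob_space (E s)" for s unfolding E_def using r' by (rule prob_space_exponential_density)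
  have N: "prob_space (N s)" for s unfolding N_def
    by (intro prob_space_pair measure_pmf.prob_space_axioms E)
  interpret PP: product_prob_space "\<lambda>(n::nat, s). N s" "UNIV :: (nat \<times> 's) set"
    by (simp add: product_prob_spaceI N split: prod.split)
  have pM: "prob_space M" unfolding M_def by (rule PP.prob_space_axioms)
  have d: "d s \<in> S - {s}" if "s \<in> S" for s
  proof -
    have "S - {s} \<noteq> {}"
    proof
      assume "S - {s} = {}"
      then have "exit_rate S q s = 0" unfolding exit_rate_def by (simp only: sum.empty)
      with r[OF that] show False by simp
    qed
    then show ?thesis unfolding d_def by (metis ex_in_conv someI_ex)
  qed
  have jp: "0 \<le> jump_prob S q s s'" if "s \<in> S" "s' \<in> S" for s s'
    using q[of s s'] r[of s] that by (auto simp: jump_prob_def)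
  have K: "pmf (K s) s' = (if s' \<in> S then jump_prob S q s s' else 0)" if s: "s \<in> S" for s s'
  proof -
    have "(\<integral>\<^sup>+x. ennreal (if x \<in> S then jump_prob S q s x else 0) \<partial>count_space UNIV) =
        (\<integral>\<^sup>+x. ennreal (jump_prob S q s x) \<partial>count_space S)"
      by (subst (2) nn_integral_count_space_indicator) (auto intro!: nn_integral_cong)
    also have "\<dots> = ennreal (\<Sum>x\<in>S. jump_prob S q s x)"
      using S jp s by (simp add: nn_integral_count_space_finite)
    also have "(\<Sum>x\<in>S. jump_prob S q s x) = (\<Sum>x\<in>S - {s}. q s x / exit_rate S q s)"
      using S s by (simp add: sum.remove[of S s] jump_prob_def)
    also have "\<dots> = 1"
      using r[OF s] by (simp add: sum_divide_distrib[symmetric] exit_rate_def)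
    finally have 1: "(\<integral>\<^sup>+x. ennreal (if x \<in> S then jump_prob S q s x else 0) \<partial>count_space UNIV) = 1"
      by simp
    have "pmf (embed_pmf (\<lambda>s'. if s' \<in> S then jump_prob S q s s' else 0)) s' =
        (if s' \<in> S then jump_prob S q s s' else 0)"
      by (rule pmf_embed_pmf) (use 1 jp[OF s] in auto)
    then show ?thesis using s by (simp add: K_def)
  qed
  have pK: "measure (measure_pmf (K s)) {x. nx s x = s'} = jump_prob S q s s'"
    if s: "s \<in> S" "s' \<in> S" for s s'
  proof (cases "s' = s")
    case True
    then have "{x. nx s x = s'} = {}" using d[OF s(1)] by (auto simp: nx_def)
    then show ?thesis using True by (simp add: jump_prob_def)
  next
    case False
    have "set_pmf (K s) \<subseteq> S - {s}"
      using K[OF s(1)] by (auto simp: set_pmf_eq jump_prob_def split: if_splits)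
    then have "{x. nx s x = s'} \<inter> set_pmf (K s) = {s'} \<inter> set_pmf (K s)"
      by (auto simp: nx_def)
    then have "measure (measure_pmf (K s)) {x. nx s x = s'} = measure (measure_pmf (K s)) {s'}"
      by (metis measure_Int_set_pmf)
    then show ?thesis using K[OF s(1), of s'] s by (simp add: measure_pmf_single)
  qed
  have [measurable]: "ho \<in> borel_measurable borel" unfolding ho_def by measurable
  have sE [measurable_cong]: "sets (E s) = sets borel" for s by (simp add: E_def)
  have spE [simp]: "space (E s) = UNIV" for s by (simp add: E_def)
  have pE: "measure (E s) {u. t < ho u} = exp (- exit_rate S q s * t)"
    if s: "s \<in> S" and t: "0 \<le> t" for s t
  proof -
    interpret E: prob_space "E s" by (rule E)
    have "distributed (E s) lborel (\<lambda>x. x) (exponential_density (r' s))"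
      unfolding distributed_def E_def by (auto simp: distr_id2 exponential_density_nonneg r')
    from E.exponential_distributedD_gt[OF this t r'] s
    have gt: "measure (E s) {u. t < u} = exp (- exit_rate S q s * t)" if "0 \<le> t" for t
      using that E.exponential_distributedD_gt[OF \<open>distributed _ _ _ _\<close> that r'] s
      by (simp add: r'_def mult.commute)
    have "measure (E s) {u. 0 < u} = 1" using gt[of 0] by simp
    then have "AE u in E s. 0 < u" using E.prob_Collect_eq_1[of "\<lambda>u. 0 < u"] by simp
    then have "measure (E s) {u. t < ho u} = measure (E s) {u. t < u}"
      by (intro measure_eq_AE) (auto simp: ho_def)
    then show ?thesis using gt[OF t] by simp
  qed
  have pN: "measure (N s) ({x. nx s x = s'} \<times> {u. t < ho u}) =
      jump_prob S q s s' * exp (- exit_rate S q s * t)"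
    if s: "s \<in> S" "s' \<in> S" and t: "0 \<le> t" for s s' t
  proof -
    interpret E: prob_space "E s" by (rule E)
    have "emeasure (N s) ({x. nx s x = s'} \<times> {u. t < ho u}) =
        emeasure (measure_pmf (K s)) {x. nx s x = s'} * emeasure (E s) {u. t < ho u}"
      unfolding N_def by (rule E.emeasure_pair_measure_Times) auto
    then show ?thesis using pK[OF s] pE[OF s(1) t]
      by (simp add: measure_def enn2real_mult)
  qed

  define Y where "Y \<omega> = rec_nat s0 (\<lambda>n s. nx s (fst (\<omega> (n, s))))" for \<omega> :: "nat \<times> 's \<Rightarrow> 's \<times> real"
  define H where "H \<omega> n = ho (snd (\<omega> (n, Y \<omega> n)))" for \<omega> n
  have Y0: "Y \<omega> 0 = s0" and YS: "Y \<omega> (Suc n) = nx (Y \<omega> n) (fst (\<omega> (n, Y \<omega> n)))" for \<omega> n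
    by (simp_all add: Y_def)
  have nx: "nx s x \<in> S - {s}" if "s \<in> S" for s x using d[OF that] by (auto simp: nx_def)
  have YS': "Y \<omega> n \<in> S" for \<omega> n by (induction n) (use nx s0 in \<open>auto simp: Y0 YS\<close>)
  have Yne: "Y \<omega> (Suc n) \<noteq> Y \<omega> n" for \<omega> n using nx[OF YS'] by (auto simp: YS)
  have H0: "0 < H \<omega> n" for \<omega> n by (simp add: H_def ho_def)
  have comp: "(\<lambda>\<omega>. \<omega> (n, s)) \<in> M \<rightarrow>\<^sub>M N s" for n s
    unfolding M_def using measurable_component_singleton[of "(n, s)" UNIV "\<lambda>(n::nat, s). N s"] by simp
  have c1: "(\<lambda>\<omega>. fst (\<omega> (n, s))) \<in> M \<rightarrow>\<^sub>M count_space UNIV" for n s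
    using measurable_compose[OF comp[of n s, unfolded N_def] measurable_fst] by simp
  have c2: "(\<lambda>\<omega>. snd (\<omega> (n, s))) \<in> borel_measurable M" for n s
    using measurable_compose[OF comp[of n s, unfolded N_def] measurable_snd]
    by (simp add: measurable_cong_sets[OF refl sE])
  have mY [measurable]: "(\<lambda>\<omega>. Y \<omega> n) \<in> M \<rightarrow>\<^sub>M count_space S" for n
  proof (induction n)
    case (Suc n)
    have *: "(\<lambda>\<omega>. nx s (fst (\<omega> (n, s)))) \<in> M \<rightarrow>\<^sub>M count_space S" if "s \<in> S" for s
      using nx[OF that] by (intro measurable_compose[OF c1[of n s]]) auto
    show ?case unfolding YS
      by (rule measurable_compose_countable'[OF * Suc]) (use S in \<open>auto intro: countable_finite\<close>)
  qed (simp add: Y0 s0)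
  have mH [measurable]: "(\<lambda>\<omega>. H \<omega> n) \<in> borel_measurable M" for n
  proof -
    have *: "(\<lambda>\<omega>. ho (snd (\<omega> (n, s)))) \<in> borel_measurable M" for s
      using measurable_compose[OF c2[of n s], of ho borel] by simp
    show ?thesis unfolding H_def
      by (rule measurable_compose_countable'[OF * mY]) (use S in \<open>auto intro: countable_finite\<close>)
  qed

  define X where "X t \<omega> = step_path (Y \<omega>) (H \<omega>) t" for t \<omega>
  have jc: "jump_chain X n \<omega> = Y \<omega> n" for n \<omega>
    using jump_chain_step_path[of "Y \<omega>" "H \<omega>" X \<omega>] Yne H0 by (simp add: X_def)
  have ht: "holding_time X n \<omega> = H \<omega> n" for n \<omega>
    using holding_time_step_path[of "Y \<omega>" "H \<omega>" X \<omega>] Yne H0 by (simp add: X_def)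
  have law: "measure M {\<omega> \<in> space M. (\<forall>i\<le>n. jump_chain X i \<omega> = y i) \<and> (\<forall>i<n. t i < holding_time X i \<omega>)} =
        (if y 0 = s0
         then \<Prod>i<n. jump_prob S q (y i) (y (Suc i)) * exp (- exit_rate S q (y i) * t i)
         else 0)"
    if y: "\<forall>i\<le>n. y i \<in> S" and t: "\<forall>i<n. 0 \<le> t i" for n y t
  proof (cases "y 0 = s0")
    case False
    then have "{\<omega> \<in> space M. (\<forall>i\<le>n. jump_chain X i \<omega> = y i) \<and> (\<forall>i<n. t i < holding_time X i \<omega>)} = {}"
      by (auto simp: jc Y0 dest!: spec[of _ 0])
    then show ?thesis using False by (simp only: measure_empty if_False)
  next
    case True
    let ?I = "(\<lambda>i. (i, y i)) ` {..<n}"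
    define A where "A = (\<lambda>(i, s). {x. nx s x = y (Suc i)} \<times> {u. t i < ho u})"
    have "{\<omega> \<in> space M. (\<forall>i\<le>n. jump_chain X i \<omega> = y i) \<and> (\<forall>i<n. t i < holding_time X i \<omega>)} =
        {\<omega> \<in> space M. \<forall>k\<in>?I. \<omega> k \<in> A k}"
    proof (intro Collect_cong conj_cong refl iffI)
      fix \<omega> assume "(\<forall>i\<le>n. jump_chain X i \<omega> = y i) \<and> (\<forall>i<n. t i < holding_time X i \<omega>)"
      then have 1: "\<And>i. i \<le> n \<Longrightarrow> Y \<omega> i = y i" and 2: "\<And>i. i < n \<Longrightarrow> t i < H \<omega> i"
        by (auto simp: jc ht)
      have "\<omega> (i, y i) \<in> A (i, y i)" if "i < n" for i
        using 1[of i] 1[of "Suc i"] 2[of i] that by (auto simp: A_def YS H_def mem_Times_iff)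
      then show "\<forall>k\<in>?I. \<omega> k \<in> A k" by auto
    next
      fix \<omega> assume *: "\<forall>k\<in>?I. \<omega> k \<in> A k"
      have 1: "Y \<omega> i = y i" if "i \<le> n" for i using that
      proof (induction i)
        case (Suc i)
        then show ?case using *[rule_format, of "(i, y i)"] by (auto simp: A_def YS mem_Times_iff)
      qed (simp add: Y0 True)
      have "t i < H \<omega> i" if "i < n" for i
        using *[rule_format, of "(i, y i)"] 1[of i] that by (auto simp: A_def H_def mem_Times_iff)
      with 1 show "(\<forall>i\<le>n. jump_chain X i \<omega> = y i) \<and> (\<forall>i<n. t i < holding_time X i \<omega>)"
        by (auto simp: jc ht)
    qed
    moreover have "emeasure M {\<omega> \<in> space M. \<forall>k\<in>?I. \<omega> k \<in> A k} =
        (\<Prod>k\<in>?I. emeasure (case k of (n, s) \<Rightarrow> N s) (A k))"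
      unfolding M_def
    proof (rule PP.emeasure_PiM_Collect)
      fix k assume "k \<in> ?I"
      then show "A k \<in> sets (case k of (n, s) \<Rightarrow> N s)"
        by (auto simp: A_def N_def intro!: pair_measureI)
    qed auto
    moreover have "(\<Prod>k\<in>?I. emeasure (case k of (n, s) \<Rightarrow> N s) (A k)) =
        ennreal (\<Prod>k\<in>?I. measure (case k of (n, s) \<Rightarrow> N s) (A k))"
      by (subst prod_ennreal[symmetric]) (auto simp: PP.M.emeasure_eq_measure intro!: prod.cong)
    ultimately have "measure M {\<omega> \<in> space M. (\<forall>i\<le>n. jump_chain X i \<omega> = y i) \<and> (\<forall>i<n. t i < holding_time X i \<omega>)}
        = (\<Prod>k\<in>?I. measure (case k of (n, s) \<Rightarrow> N s) (A k))"
      unfolding measure_def[of M] by (simp only: enn2real_ennreal prod_nonneg measure_nonneg)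
    also have "\<dots> = (\<Prod>i<n. measure (N (y i)) (A (i, y i)))"
      by (subst prod.reindex) (auto simp: inj_on_def)
    also have "\<dots> = (\<Prod>i<n. jump_prob S q (y i) (y (Suc i)) * exp (- exit_rate S q (y i) * t i))"
      using y t by (intro prod.cong refl) (simp add: A_def pN)
    finally show ?thesis using True by simp
  qed
  have "ctmc M X S q s0"
    unfolding ctmc_def
  proof (intro conjI allI impI ballI)
    show "X t \<in> M \<rightarrow>\<^sub>M count_space S" for t
      unfolding X_def using mY mH by (rule measurable_step_path)
    show "\<forall>\<^sub>F u in at_right t. X u \<omega> = X t \<omega>" if "0 \<le> t" for t \<omega>
      unfolding X_def using Yne H0 that by (rule step_path_right_cont)
    show "jump_chain X n \<in> M \<rightarrow>\<^sub>M count_space S" for n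
      using mY[of n] by (simp add: jc[abs_def] cong: measurable_cong)
    show "holding_time X n \<in> borel_measurable M" for n
      using mH[of n] by (simp add: ht[abs_def] cong: measurable_cong)
  qed (use pM law in auto)
  then show ?thesis by blast
qed

lemma finite_tandem_states: "finite (tandem_states J B)"
  unfolding tandem_states_def by (intro finite_PiE) auto

context
  fixes J :: nat and \<mu> :: "nat \<Rightarrow> real" and lam :: real and F :: "real \<Rightarrow> real"
    and \<pi> :: "state \<Rightarrow> real"
  assumes J: "1 \<le> J" and \<mu>: "\<forall>j\<in>{1..J}. 0 < \<mu> j" and l: "\<And>s. 0 < lam * (1 - left_lim F (\<pi> s))"
begin

lemma tandem_rate_parts:
  fixes s s' :: state
  shows "0 \<le> (if s' = arrive s then lam * (1 - left_lim F (\<pi> s)) else 0)"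
  "0 \<le> (\<Sum>j=1..<J. if 0 < s j \<and> s' = move j s then \<mu> j else 0)"
  "0 \<le> (if 0 < s J \<and> s' = depart J s then \<mu> J else 0)"
proof -
  have \<mu>': "0 \<le> \<mu> j" if "j \<in> {1..J}" for j using \<mu> that by (simp add: less_imp_le)
  show "0 \<le> (if s' = arrive s then lam * (1 - left_lim F (\<pi> s)) else 0)"
    using less_imp_le[OF l] by simp
  show "0 \<le> (\<Sum>j=1..<J. if 0 < s j \<and> s' = move j s then \<mu> j else 0)"
    using \<mu>' by (intro sum_nonneg) auto
  show "0 \<le> (if 0 < s J \<and> s' = depart J s then \<mu> J else 0)"
    using \<mu>' J by simp
qed

lemma tandem_rate_nonneg: "0 \<le> tandem_rate J B lam \<mu> F \<pi> s s'"
  using tandem_rate_parts(1)[where s=s and s'=s'] tandem_rate_parts(2,3)[of s s'] unfolding tandem_rate_def by (smt (verit))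

lemma exit_rate_tandem_pos:
  assumes s: "s \<in> tandem_states J B"
  shows "0 < exit_rate (tandem_states J B) (tandem_rate J B lam \<mu> F \<pi>) s"
proof -
  let ?S = "tandem_states J B" and ?q = "tandem_rate J B lam \<mu> F \<pi>"
  have bound: "s j \<le> B j + 1" if "j \<in> {1..J}" for j
    using PiE_mem[OF s[unfolded tandem_states_def] that] by simp
  have upd: "s(j := v) \<in> ?S" if "s \<in> ?S" "j \<in> {1..J}" "v \<le> B j + 1" for s j v
    using that by (auto simp: tandem_states_def PiE_iff extensional_def)
  have "\<exists>s'\<in>?S - {s}. 0 < ?q s s'"
  proof (cases "\<exists>j\<in>{1..J}. 0 < s j")
    case False
    then have "s 1 = 0" using J by auto
    then have "arrive s \<in> ?S"
      unfolding arrive_def using s J by (intro upd) auto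
    moreover have "arrive s \<noteq> s" by (auto simp: arrive_def fun_eq_iff)
    moreover have "0 < ?q s (arrive s)"
      using tandem_rate_parts(1)[where s=s and s'="arrive s"] tandem_rate_parts(2,3)[of s "arrive s"] l[of s] s \<open>arrive s \<in> ?S\<close>
      unfolding tandem_rate_def by (smt (verit))
    ultimately show ?thesis by blast
  next
    case True
    define j where "j = Max {j\<in>{1..J}. 0 < s j}"
    have "j \<in> {j\<in>{1..J}. 0 < s j}" unfolding j_def using True by (intro Max_in) auto
    then have j: "j \<in> {1..J}" "0 < s j" by auto
    have j': "s k = 0" if "j < k" "k \<le> J" for k
    proof (rule ccontr)
      assume "s k \<noteq> 0"
      then have "k \<le> j" unfolding j_def using that by (intro Max_ge) auto
      with that show False by simp
    qed
    have b: "s j - 1 \<le> B j + 1" using bound[OF j(1)] by linarith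
    show ?thesis
    proof (cases "j = J")
      case True
      then have "depart J s \<in> ?S"
        unfolding depart_def using s j b by (intro upd) auto
      moreover have "depart J s \<noteq> s"
      proof
        assume "depart J s = s"
        then have "depart J s j = s j" by simp
        with j True show False by (simp add: depart_def)
      qed
      moreover have "0 < ?q s (depart J s)"
        using tandem_rate_parts(1)[where s=s and s'="depart J s"] tandem_rate_parts(2,3)[of s "depart J s"] s \<open>depart J s \<in> ?S\<close> j True \<mu>
        unfolding tandem_rate_def by (smt (verit))
      ultimately show ?thesis by blast
    next
      case False
      then have "j < J" using j by auto
      then have "move j s \<in> ?S"
        unfolding move_def using s j b j'[of "Suc j"] by (intro upd) auto
      moreover have "move j s \<noteq> s"
      proof
        assume "move j s = s"
        then have "move j s j = s j" by simp
        with j show False by (simp add: move_def)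
      qed
      moreover have "0 < (\<Sum>i=1..<J. if 0 < s i \<and> move j s = move i s then \<mu> i else 0)"
        using j \<open>j < J\<close> \<mu> by (intro sum_pos2[of _ j]) (auto simp: less_imp_le)
      then have "0 < ?q s (move j s)"
        using tandem_rate_parts(1)[where s=s and s'="move j s"] tandem_rate_parts(2,3)[of s "move j s"] s \<open>move j s \<in> ?S\<close>
        unfolding tandem_rate_def by (smt (verit))
      ultimately show ?thesis by blast
    qed
  qed
  then obtain s' where s': "s' \<in> ?S - {s}" "0 < ?q s s'" by blast
  show ?thesis unfolding exit_rate_def
    by (rule sum_pos2[of _ s']) (use s' finite_tandem_states[of J B] tandem_rate_nonneg in auto)
qed

corollary tandem_ctmc_exists:
  assumes "s0 \<in> tandem_states J B"
  shows "\<exists>(M :: (nat \<times> state \<Rightarrow> state \<times> real) measure) X.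
    ctmc M X (tandem_states J B) (tandem_rate J B lam \<mu> F \<pi>) s0"
  using finite_tandem_states tandem_rate_nonneg exit_rate_tandem_pos assms by (rule ctmc_exists)

end

end

theory Submission
  imports Defs
begin

text \<open>
  Let \<open>h\<close> and \<open>g\<close> solve the Poisson equation of the chain on its finite state space, so that along
  a path the collected revenue plus the increments of \<open>h\<close> has the compensator \<open>g T\<close>; hence \<open>g\<close> is
  the gain. By the maximum principle, \<open>b \<le> g\<close> as soon as some function \<open>V\<close> in place of \<open>h\<close> gives at least \<open>b\<close>
  in every state.
  Let \<open>\<psi>(s)\<close> be the mean total service time still required in state \<open>s\<close>. It grows at rate
  \<open>\<lambda>\<^sup>\<pi> \<Sum>\<^sub>j 1 / \<mu>\<^sub>j < 1\<close> and falls at rate at least \<open>1\<close> unless the system is empty, because the last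
  nonempty station is never blocked. So for small \<open>\<eta> > 0\<close> the function \<open>exp (\<eta> \<psi>)\<close> has geometric
  drift with constants that do not involve the buffer sizes, and a multiple \<open>V\<close> of \<open>- exp (\<eta> \<psi>)\<close>
  bounds the fraction of time during which station 1 is full by a multiple of
  \<open>exp (- \<eta> \<Sum>\<^sub>j 1 / \<mu>\<^sub>j)\<close> to the power \<open>B\<^sub>1\<close>.
\<close>

section \<open>The Poisson equation on a finite state space\<close>

text \<open>\<open>gain\<close> is a \<open>Lim\<close>, so it can be bounded only once the limit is
  known to exist; a drift inequality for \<open>V\<close> alone would control no more than a lower
  limit. Hence an exact solution \<open>h\<close> is produced first and compared with
  \<open>V\<close> afterwards. Its existence is pure linear algebra: the system is square, and
  uniqueness holds because service completions lower the workload, so that the empty state can be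
  reached from every state. \<open>ctmc\<close> prescribes the joint law of visited states and
  holding times, not a Markov property at fixed times. The compensator identity is therefore proved
  for one jump at a time, and the number of jumps is sent to infinity afterwards. The exponential of
  the workload is used because the gain from the drift must grow with the state: it has to repay the
  revenue lost while station 1 is full, yet its correction term, which is due to the empty system,
  has to be tiny. The ratio of these two sizes is the error term.\<close>

lemma underdetermined_system:
  fixes A :: "'i \<Rightarrow> 'k \<Rightarrow> real"
  assumes "finite I" "finite K" "card I < card K"
  shows "\<exists>x. (\<exists>k\<in>K. x k \<noteq> 0) \<and> (\<forall>i\<in>I. (\<Sum>k\<in>K. A i k * x k) = 0)"
  using assms
proof (induction I arbitrary: K A)
  case empty
  then have "K \<noteq> {}" by auto
  then show ?case by (intro exI[of _ "\<lambda>_. 1"]) auto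
next
  case (insert i I)
  show ?case
  proof (cases "\<forall>k\<in>K. A i k = 0")
    case True
    have "card I < card K" using insert by simp
    from insert.IH[OF \<open>finite K\<close> this, of A] True show ?thesis by auto
  next
    case False
    \<comment> \<open>Gaussian elimination: \<open>p\<close> is a pivot of equation
      \<open>i\<close>. It is eliminated from the other equations, and \<open>z\<close> recovers its
      value from equation \<open>i\<close>.\<close>
    then obtain p where p: "p \<in> K" "A i p \<noteq> 0" by auto
    have "card I < card (K - {p})" using insert p by simp
    with insert.IH[of "K - {p}" "\<lambda>j k. A j k - A j p * A i k / A i p"] insert.prems
    obtain x where x: "\<exists>k\<in>K - {p}. x k \<noteq> 0"
      "\<And>j. j \<in> I \<Longrightarrow> (\<Sum>k\<in>K - {p}. (A j k - A j p * A i k / A i p) * x k) = 0"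
      by auto
    define z where "z = x(p := - (\<Sum>k\<in>K - {p}. A i k * x k) / A i p)"
    have z: "(\<Sum>k\<in>K. A j k * z k) = A j p * z p + (\<Sum>k\<in>K - {p}. A j k * x k)" for j
      using insert.prems(1) p by (simp add: sum.remove[of K p] z_def)
    have "(\<Sum>k\<in>K. A i k * z k) = 0" using p by (simp add: z) (simp add: z_def)
    moreover have "(\<Sum>k\<in>K. A j k * z k) = 0" if "j \<in> I" for j
    proof -
      have "(\<Sum>k\<in>K - {p}. (A j k - A j p * A i k / A i p) * x k) =
          (\<Sum>k\<in>K - {p}. A j k * x k) - A j p / A i p * (\<Sum>k\<in>K - {p}. A i k * x k)"
        unfolding sum_distrib_left sum_subtractf[symmetric]
        by (intro sum.cong refl) (simp add: field_simps p)
      with x(2)[OF that] show ?thesis by (simp add: z) (simp add: z_def)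
    qed
    moreover have "\<exists>k\<in>K. z k \<noteq> 0" using x(1) by (auto simp: z_def)
    ultimately show ?thesis by blast
  qed
qed

text \<open>Injectivity implies surjectivity for a square matrix. With the extra column
  \<open>b\<close>, indexed by \<open>None\<close>, the system is underdetermined and has a
  nontrivial kernel vector; injectivity forces its \<open>None\<close> entry to be nonzero, so it
  can be scaled to \<open>-1\<close>.\<close>

lemma square_system_solvable:
  fixes A :: "'s \<Rightarrow> 's \<Rightarrow> real"
  assumes S: "finite S"
    and ker: "\<And>x. (\<And>i. i \<in> S \<Longrightarrow> (\<Sum>k\<in>S. A i k * x k) = 0) \<Longrightarrow> \<forall>k\<in>S. x k = 0"
  shows "\<exists>x. \<forall>i\<in>S. (\<Sum>k\<in>S. A i k * x k) = b i"
proof -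
  let ?K = "insert None (Some ` S)"
  have "card S < card ?K" using S by (simp add: card_image)
  with underdetermined_system[of S ?K "\<lambda>i k. case k of None \<Rightarrow> b i | Some k \<Rightarrow> A i k"] S
  obtain x where x0: "\<exists>k\<in>?K. x k \<noteq> 0" and
    x: "\<And>i. i \<in> S \<Longrightarrow> (\<Sum>k\<in>?K. (case k of None \<Rightarrow> b i | Some k \<Rightarrow> A i k) * x k) = 0"
    by auto
  have x': "b i * x None + (\<Sum>k\<in>S. A i k * x (Some k)) = 0" if "i \<in> S" for i
    using x[OF that] S by (simp add: sum.reindex)
  have "x None \<noteq> 0"
  proof
    assume 0: "x None = 0"
    then have "\<forall>k\<in>S. x (Some k) = 0" using x' by (intro ker) simp
    with 0 x0 show False by auto
  qed
  have "(\<Sum>k\<in>S. A i k * (- x (Some k) / x None)) = b i" if "i \<in> S" for i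
  proof -
    have "(\<Sum>k\<in>S. A i k * (- x (Some k) / x None)) = - (\<Sum>k\<in>S. A i k * x (Some k)) / x None"
      unfolding sum_negf[symmetric] sum_divide_distrib by (intro sum.cong refl) simp
    also have "\<dots> = b i" using x'[OF that] \<open>x None \<noteq> 0\<close> by (simp add: field_simps)
    finally show ?thesis .
  qed
  then show ?thesis by (intro exI[of _ "\<lambda>k. - x (Some k) / x None"] ballI)
qed

text \<open>Any maximiser of \<open>h\<close> on \<open>S\<close> will do, since every increment of
  \<open>h\<close> out of it is nonpositive.\<close>

lemma max_principle:
  fixes h :: "'s \<Rightarrow> real" and q :: "'s \<Rightarrow> 's \<Rightarrow> real"
  assumes S: "finite S" "S \<noteq> {}"
    and q: "\<And>s s'. s \<in> S \<Longrightarrow> s' \<in> S \<Longrightarrow> s \<noteq> s' \<Longrightarrow> 0 \<le> q s s'"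
  shows "\<exists>s\<in>S. (\<Sum>s'\<in>S - {s}. q s s' * (h s' - h s)) \<le> 0"
proof -
  have "finite (h ` S)" "h ` S \<noteq> {}" using S by auto
  from Max_in[OF this] obtain s where s: "s \<in> S" "h s = Max (h ` S)" by auto
  have m: "h s' \<le> h s" if "s' \<in> S" for s' using S s that by simp
  have "(\<Sum>s'\<in>S - {s}. q s s' * (h s' - h s)) \<le> 0"
    using q s m by (intro sum_nonpos mult_nonneg_nonpos) auto
  with s(1) show ?thesis by (rule bexI[rotated])
qed

text \<open>Where a harmonic function attains its maximum, so do all successors of positive rate. A
  maximiser with least \<open>f\<close> therefore cannot have the successor of smaller
  \<open>f\<close> that \<open>d\<close> provides, and must be \<open>z\<close>.\<close>

lemma harmonic_le:
  fixes h f :: "'s \<Rightarrow> real" and q :: "'s \<Rightarrow> 's \<Rightarrow> real"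
  assumes S: "finite S" "S \<noteq> {}"
    and q: "\<And>s s'. s \<in> S \<Longrightarrow> s' \<in> S \<Longrightarrow> s \<noteq> s' \<Longrightarrow> 0 \<le> q s s'"
    and d: "\<And>s. s \<in> S \<Longrightarrow> s \<noteq> z \<Longrightarrow> \<exists>s'\<in>S. 0 < q s s' \<and> f s' < f s"
    and h: "\<And>s. s \<in> S \<Longrightarrow> (\<Sum>s'\<in>S - {s}. q s s' * (h s' - h s)) = 0"
    and t: "t \<in> S"
  shows "h t \<le> h z"
proof -
  define m where "m = Max (h ` S)"
  have m: "h s \<le> m" if "s \<in> S" for s using S that by (simp add: m_def)
  define K where "K = {s\<in>S. h s = m}"
  have "m \<in> h ` S" unfolding m_def using S by (intro Max_in) auto
  then have "f ` K \<noteq> {}" "finite (f ` K)" using S by (auto simp: K_def)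
  from Min_in[OF this(2,1)] obtain s where s: "s \<in> K" "f s = Min (f ` K)" by auto
  have "s = z"
  proof (rule ccontr)
    assume "s \<noteq> z"
    with s d[of s] obtain s' where s': "s' \<in> S" "0 < q s s'" "f s' < f s" by (auto simp: K_def)
    have "s' \<notin> K"
    proof
      assume "s' \<in> K"
      then have "Min (f ` K) \<le> f s'" using \<open>finite (f ` K)\<close> by (intro Min_le imageI)
      with s(2) s'(3) show False by simp
    qed
    then have "h s' < h s" using m[OF s'(1)] s s' by (auto simp: K_def)
    have "(\<Sum>s'\<in>S - {s}. q s s' * (h s - h s')) > 0"
    proof (rule sum_pos2[of _ s'])
      show "0 < q s s' * (h s - h s')" using s' \<open>h s' < h s\<close> by simp
      show "0 \<le> q s i * (h s - h i)" if "i \<in> S - {s}" for i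
        using that q[of s i] m[of i] s by (intro mult_nonneg_nonneg) (auto simp: K_def)
    qed (use S s' in auto)
    moreover have "(\<Sum>s'\<in>S - {s}. q s s' * (h s - h s')) = - (\<Sum>s'\<in>S - {s}. q s s' * (h s' - h s))"
      unfolding sum_negf[symmetric] by (intro sum.cong refl) (simp add: algebra_simps)
    ultimately show False using h[of s] s by (simp add: K_def)
  qed
  with s m[OF t] show ?thesis by (simp add: K_def)
qed

text \<open>By \<open>square_system_solvable\<close> only uniqueness has to be shown. A vector in
  the kernel is a function vanishing at \<open>z\<close> on which the generator is constant; the
  maximum principle makes this constant \<open>0\<close>, and \<open>harmonic_le\<close> makes the
  function \<open>0\<close>.\<close>

lemma poisson_equation_solvable:
  fixes f :: "'s \<Rightarrow> real" and q R :: "'s \<Rightarrow> 's \<Rightarrow> real"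
  assumes S: "finite S" and z: "z \<in> S"
    and q: "\<And>s s'. s \<in> S \<Longrightarrow> s' \<in> S \<Longrightarrow> s \<noteq> s' \<Longrightarrow> 0 \<le> q s s'"
    and d: "\<And>s. s \<in> S \<Longrightarrow> s \<noteq> z \<Longrightarrow> \<exists>s'\<in>S. 0 < q s s' \<and> f s' < f s"
  shows "\<exists>g h. \<forall>s\<in>S. (\<Sum>s'\<in>S - {s}. q s s' * (R s s' + h s' - h s)) = g"
proof -
  define L where "L h s = (\<Sum>s'\<in>S - {s}. q s s' * (h s' - h s))" for h :: "'s \<Rightarrow> real" and s
  have ne: "S \<noteq> {}" using z by auto
  \<comment> \<open>The unknown vector carries \<open>g\<close> in place of \<open>h z\<close>, which may be normalised to \<open>0\<close>.\<close>
  define A where "A s k = (if k = z then 1 else if k = s then exit_rate S q s else - q s k)" for s k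
  have A: "(\<Sum>k\<in>S. A s k * x k) = x z - L (x(z := 0)) s" if s: "s \<in> S" for x s
  proof -
    have L: "L (x(z := 0)) s = (\<Sum>k\<in>S - {s}. q s k * (x(z := 0)) k) - exit_rate S q s * (x(z := 0)) s"
      unfolding L_def exit_rate_def
      by (simp only: right_diff_distrib sum_subtractf sum_distrib_right)
    have "(\<Sum>k\<in>S. A s k * x k) = x z + (\<Sum>k\<in>S - {z}. A s k * x k)"
      using S z by (simp add: sum.remove[of S z] A_def)
    also have "(\<Sum>k\<in>S - {z}. A s k * x k) =
        (\<Sum>k\<in>S - {z}. (if k = s then exit_rate S q s else - q s k) * (x(z := 0)) k)"
      by (intro sum.cong) (auto simp: A_def)
    also have "\<dots> = (\<Sum>k\<in>S. (if k = s then exit_rate S q s else - q s k) * (x(z := 0)) k)"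
      using S z by (simp add: sum.remove[of S z])
    also have "\<dots> = exit_rate S q s * (x(z := 0)) s + (\<Sum>k\<in>S - {s}. - q s k * (x(z := 0)) k)"
      using S s by (subst sum.remove[of S s]) (auto intro!: sum.cong)
    finally show ?thesis unfolding L by (simp add: sum_negf)
  qed
  have "\<exists>x. \<forall>s\<in>S. (\<Sum>k\<in>S. A s k * x k) = (\<Sum>s'\<in>S - {s}. q s s' * R s s')"
  proof (rule square_system_solvable[OF S])
    fix x assume "\<And>s. s \<in> S \<Longrightarrow> (\<Sum>k\<in>S. A s k * x k) = 0"
    then have x: "L (x(z := 0)) s = x z" if "s \<in> S" for s using A[OF that, of x] that by simp
    have Lm: "L (\<lambda>s. - h s) s = - L h s" for h s
      unfolding L_def sum_negf[symmetric] by (intro sum.cong refl) (simp add: algebra_simps)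
    \<comment> \<open>The generator takes the constant value \<open>x z\<close>. The maximum
      principle for the function bounds it above by \<open>0\<close>, that for its negative bounds
      it below by \<open>0\<close>.\<close>
    have "\<exists>s\<in>S. L (x(z := 0)) s \<le> 0" "\<exists>s\<in>S. L (\<lambda>s. - (x(z := 0)) s) s \<le> 0"
      unfolding L_def by (rule max_principle[OF S ne q]; assumption)+
    then obtain s s' where "s \<in> S" "L (x(z := 0)) s \<le> 0" "s' \<in> S" "L (\<lambda>s. - (x(z := 0)) s) s' \<le> 0"
      by (elim bexE)
    then have xz: "x z = 0" using x[of s] x[of s'] Lm[of "x(z := 0)" s'] by simp
    then have L0: "L (x(z := 0)) s = 0" if "s \<in> S" for s using x that by simp
    show "\<forall>k\<in>S. x k = 0"
    proof
      fix k assume k: "k \<in> S"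
      have "(x(z := 0)) k \<le> (x(z := 0)) z"
        using L0 k unfolding L_def by (intro harmonic_le[OF S ne q d])
      moreover have "- (x(z := 0)) k \<le> - (x(z := 0)) z"
        using L0 k Lm[of "x(z := 0)"] unfolding L_def
        by (intro harmonic_le[OF S ne q d, where h="\<lambda>s. - (x(z := 0)) s"]) auto
      ultimately show "x k = 0" using xz by (auto split: if_splits)
    qed
  qed
  then obtain x where x: "\<And>s. s \<in> S \<Longrightarrow> (\<Sum>k\<in>S. A s k * x k) = (\<Sum>s'\<in>S - {s}. q s s' * R s s')"
    by auto
  show ?thesis
  proof (intro exI ballI)
    fix s assume s: "s \<in> S"
    have "(\<Sum>s'\<in>S - {s}. q s s' * (R s s' + (x(z := 0)) s' - (x(z := 0)) s)) =
        (\<Sum>s'\<in>S - {s}. q s s' * R s s') + L (x(z := 0)) s"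
      unfolding L_def by (simp only: sum.distrib[symmetric] distrib_left[symmetric] add_diff_eq)
    then show "(\<Sum>s'\<in>S - {s}. q s s' * (R s s' + (x(z := 0)) s' - (x(z := 0)) s)) = x z"
      using x[OF s] A[OF s, of x] by simp
  qed
qed

text \<open>The rewards cancel in the difference of the two expressions, which leaves the generator
  applied to \<open>V - h\<close>; it is nonpositive at a maximiser of \<open>V - h\<close>, and
  there \<open>b\<close> and \<open>g\<close> can be compared.\<close>

lemma poisson_equation_lower_bound:
  fixes h V :: "'s \<Rightarrow> real" and q R :: "'s \<Rightarrow> 's \<Rightarrow> real"
  assumes S: "finite S" "S \<noteq> {}"
    and q: "\<And>s s'. s \<in> S \<Longrightarrow> s' \<in> S \<Longrightarrow> s \<noteq> s' \<Longrightarrow> 0 \<le> q s s'"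
    and h: "\<And>s. s \<in> S \<Longrightarrow> (\<Sum>s'\<in>S - {s}. q s s' * (R s s' + h s' - h s)) = g"
    and V: "\<And>s. s \<in> S \<Longrightarrow> b \<le> (\<Sum>s'\<in>S - {s}. q s s' * (R s s' + V s' - V s))"
  shows "b \<le> g"
proof -
  have "\<exists>s\<in>S. (\<Sum>s'\<in>S - {s}. q s s' * ((V s' - h s') - (V s - h s))) \<le> 0"
    by (rule max_principle[OF S q])
  then obtain s where s: "s \<in> S" "(\<Sum>s'\<in>S - {s}. q s s' * ((V s' - h s') - (V s - h s))) \<le> 0"
    by (elim bexE)
  have "(\<Sum>s'\<in>S - {s}. q s s' * ((V s' - h s') - (V s - h s))) =
      (\<Sum>s'\<in>S - {s}. q s s' * (R s s' + V s' - V s)) - (\<Sum>s'\<in>S - {s}. q s s' * (R s s' + h s' - h s))"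
    unfolding sum_subtractf[symmetric] by (intro sum.cong refl) (simp add: algebra_simps)
  with s V[of s] h[of s] show ?thesis by simp
qed

section \<open>Average rewards of finite Markov chains\<close>

lemma (in prob_space) nn_integral_finite_partition:
  assumes V: "finite V" and A: "\<And>v. v \<in> V \<Longrightarrow> A v \<in> events"
    and part: "\<And>x. x \<in> space M \<Longrightarrow> c x \<in> V"
      "\<And>x v. x \<in> space M \<Longrightarrow> v \<in> V \<Longrightarrow> x \<in> A v \<longleftrightarrow> v = c x"
    and f: "f \<in> borel_measurable M"
  shows "(\<integral>\<^sup>+x. f x \<partial>M) = (\<Sum>v\<in>V. \<integral>\<^sup>+x. f x * indicator (A v) x \<partial>M)"
proof -
  have "(\<Sum>v\<in>V. \<integral>\<^sup>+x. f x * indicator (A v) x \<partial>M) = (\<integral>\<^sup>+x. (\<Sum>v\<in>V. f x * indicator (A v) x) \<partial>M)"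
    using A f by (intro nn_integral_sum[symmetric]) auto
  also have "\<dots> = (\<integral>\<^sup>+x. f x \<partial>M)"
  proof (rule nn_integral_cong)
    fix x assume x: "x \<in> space M"
    have "(\<Sum>u\<in>V. f x * indicator (A u) x) = (\<Sum>u\<in>{c x}. f x * indicator (A u) x)"
      using V part[OF x] by (intro sum.mono_neutral_right) (auto simp: indicator_def)
    then show "(\<Sum>v\<in>V. f x * indicator (A v) x) = f x"
      using part(2)[OF x part(1)[OF x]] by simp
  qed
  finally show ?thesis by simp
qed

text \<open>With \<open>x = T - u\<close> this is the identity \<open>P (h \<le> x) = r E (min h x)\<close>; it replaces any bound on
  the overshoot of the first jump time after \<open>T\<close>.\<close>

lemma nn_integral_exponential_indicator_le:
  assumes r: "0 < r"
  shows "(\<integral>\<^sup>+h. indicator {..T} (u + h) \<partial>density lborel (exponential_density r)) =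
    ennreal r * (\<integral>\<^sup>+h. ennreal (min (u + h) T - min u T) \<partial>density lborel (exponential_density r))"
proof -
  let ?E = "density lborel (exponential_density r)"
  let ?D = "exponential_density r"
  have pos: "AE h in ?E. 0 \<le> h"
    by (subst AE_density) (auto simp: exponential_density_def)
  show ?thesis
  proof (cases "u \<le> T")
    case False
    have "(\<integral>\<^sup>+h. indicator {..T} (u + h) \<partial>?E) = (\<integral>\<^sup>+h. 0 \<partial>?E)"
      using pos False by (intro nn_integral_cong_AE) (auto simp: indicator_def)
    moreover have "(\<integral>\<^sup>+h. ennreal (min (u + h) T - min u T) \<partial>?E) = (\<integral>\<^sup>+h. 0 \<partial>?E)"
      using pos False by (intro nn_integral_cong_AE) auto
    ultimately show ?thesis by simp
  next
    case True
    define x where "x = T - u"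
    have x: "0 \<le> x" using True by (simp add: x_def)
    have F1: "((\<lambda>h. - exp (- h * r)) has_real_derivative exp (- h * r) * r) (at h)" for h
      by (auto intro!: derivative_eq_intros)
    have F2: "((\<lambda>h. - (h * r + 1) * exp (- h * r) / r) has_real_derivative (h * (r * exp (- h * r)))) (at h)" for h
      using r by (auto intro!: derivative_eq_intros simp: field_simps)
    have lim: "((\<lambda>h. - exp (- h * r)) \<longlongrightarrow> 0) at_top"
      using r by real_asymp
    have "(\<integral>\<^sup>+h. indicator {..T} (u + h) \<partial>?E) = (\<integral>\<^sup>+h. ennreal (?D h) * indicator {..T} (u + h) \<partial>lborel)"
      by (subst nn_integral_density) auto
    also have "\<dots> = (\<integral>\<^sup>+h. ennreal (exp (- h * r) * r) * indicator {0..x} h \<partial>lborel)"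
      by (intro nn_integral_cong) (auto simp: exponential_density_def indicator_def x_def mult.commute)
    also have "\<dots> = ennreal (- exp (- x * r) - - exp (- 0 * r))"
      using x r by (intro nn_integral_FTC_Icc[OF _ F1]) auto
    finally have l: "(\<integral>\<^sup>+h. indicator {..T} (u + h) \<partial>?E) = ennreal (1 - exp (- x * r))" by simp
    have "(\<integral>\<^sup>+h. ennreal (min (u + h) T - min u T) \<partial>?E) = (\<integral>\<^sup>+h. ennreal (?D h) * ennreal (min h x) \<partial>lborel)"
      using True by (subst nn_integral_density) (auto intro!: nn_integral_cong arg_cong2[where f="(*)"] arg_cong[where f=ennreal] simp: x_def min_def)
    also have "\<dots> = (\<integral>\<^sup>+h. ennreal (h * (r * exp (- h * r))) * indicator {0..x} h +
        ennreal x * (ennreal (exp (- h * r) * r) * indicator {x..} h) \<partial>lborel)"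
    \<comment> \<open>The ranges \<open>{0..x}\<close> and \<open>{x..}\<close> overlap in the
      single point \<open>x\<close>, a null set.\<close>
    proof (intro nn_integral_cong_AE AE_I[where N="{x}"])
      show "{h \<in> space lborel. ennreal (?D h) * ennreal (min h x) \<noteq> ennreal (h * (r * exp (- h * r))) * indicator {0..x} h +
        ennreal x * (ennreal (exp (- h * r) * r) * indicator {x..} h)} \<subseteq> {x}"
        using x r by (auto simp: exponential_density_def indicator_def min_def ennreal_mult'[symmetric] mult_ac split: if_splits)
    qed auto
    also have "\<dots> = (\<integral>\<^sup>+h. ennreal (h * (r * exp (- h * r))) * indicator {0..x} h \<partial>lborel) +
        ennreal x * (\<integral>\<^sup>+h. ennreal (exp (- h * r) * r) * indicator {x..} h \<partial>lborel)"
      by (subst nn_integral_add) (auto simp: nn_integral_cmult)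
    also have "(\<integral>\<^sup>+h. ennreal (h * (r * exp (- h * r))) * indicator {0..x} h \<partial>lborel) =
        ennreal (- (x * r + 1) * exp (- x * r) / r - (- (0 * r + 1) * exp (- 0 * r) / r))"
      using x r by (intro nn_integral_FTC_Icc[OF _ F2]) auto
    also have "- (x * r + 1) * exp (- x * r) / r - (- (0 * r + 1) * exp (- 0 * r) / r) =
        (1 - (x * r + 1) * exp (- x * r)) / r"
      using r by (simp add: field_simps)
    also have "(\<integral>\<^sup>+h. ennreal (exp (- h * r) * r) * indicator {x..} h \<partial>lborel) = ennreal (0 - - exp (- x * r))"
      using r lim by (intro nn_integral_FTC_atLeast[OF _ F1]) auto
    finally have *: "(\<integral>\<^sup>+h. ennreal (min (u + h) T - min u T) \<partial>?E) =
      ennreal ((1 - (x * r + 1) * exp (- x * r)) / r) + ennreal (x * exp (- x * r))"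
      using x by (simp add: ennreal_mult')
    \<comment> \<open>The bound \<open>1 + y \<le> exp y\<close> makes the first of the two terms
      nonnegative, so that their \<open>ennreal\<close> sum can be merged into one.\<close>
    have "(x * r + 1) * exp (- x * r) \<le> exp (x * r) * exp (- x * r)"
      using exp_ge_add_one_self[of "x * r"] by (intro mult_right_mono) (simp_all add: add.commute)
    also have "\<dots> = 1" by (simp add: exp_minus)
    finally have "0 \<le> (1 - (x * r + 1) * exp (- x * r)) / r" using r by simp
    then have "(\<integral>\<^sup>+h. ennreal (min (u + h) T - min u T) \<partial>?E) =
      ennreal ((1 - (x * r + 1) * exp (- x * r)) / r + x * exp (- x * r))"
      unfolding * using x by (intro ennreal_plus[symmetric]) auto
    also have "(1 - (x * r + 1) * exp (- x * r)) / r + x * exp (- x * r) = (1 - exp (- x * r)) / r"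
      using r by (simp add: field_simps)
    finally show ?thesis unfolding l using r by (simp add: ennreal_mult'[symmetric])
  qed
qed

text \<open>Fubini with the last coordinate innermost: for fixed earlier coordinates their sum is
  the \<open>u\<close> of \<open>nn_integral_exponential_indicator_le\<close>.\<close>

lemma nn_integral_PiM_exponential_indicator_le:
  fixes r :: "nat \<Rightarrow> real" and T :: real and n :: nat
  assumes r: "\<And>i. 0 < r i"
  defines "P \<equiv> PiM {..n} (\<lambda>i. density lborel (exponential_density (r i)))"
  shows "(\<integral>\<^sup>+x. indicator {..T} (sum x {..<Suc n}) \<partial>P) =
    ennreal (r n) * (\<integral>\<^sup>+x. ennreal (min (sum x {..<Suc n}) T - min (sum x {..<n}) T) \<partial>P)"
proof -
  let ?E = "\<lambda>i. density lborel (exponential_density (r i))"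
  interpret product_prob_space ?E UNIV
    by (intro product_prob_spaceI prob_space_exponential_density r)
  have P: "P = PiM (insert n {..<n}) ?E"
    unfolding P_def by (rule arg_cong2[where f=PiM]) auto
  have m: "(\<lambda>x. sum x {..<k}) \<in> borel_measurable (PiM (insert n {..<n}) ?E)" if "k \<le> Suc n" for k
  proof (rule borel_measurable_sum)
    fix i assume "i \<in> {..<k}"
    then have "(\<lambda>x. x i) \<in> PiM (insert n {..<n}) ?E \<rightarrow>\<^sub>M ?E i"
      using that by (intro measurable_component_singleton) auto
    then show "(\<lambda>x. x i) \<in> borel_measurable (PiM (insert n {..<n}) ?E)"
      by (simp cong: measurable_cong_sets)
  qed
  note [measurable] = m[OF order_refl] m[of n]
  have s: "sum (x(n := y)) {..<n} = sum x {..<n}" for x :: "nat \<Rightarrow> real" and y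
    by (intro sum.cong) auto
  have "(\<integral>\<^sup>+x. indicator {..T} (sum x {..<Suc n}) \<partial>P) =
      (\<integral>\<^sup>+x. \<integral>\<^sup>+y. indicator {..T} (sum x {..<n} + y) \<partial>?E n \<partial>PiM {..<n} ?E)"
    unfolding P by (subst product_nn_integral_insert) (simp_all add: s)
  also have "\<dots> = (\<integral>\<^sup>+x. ennreal (r n) * (\<integral>\<^sup>+y. ennreal (min (sum x {..<n} + y) T - min (sum x {..<n}) T) \<partial>?E n) \<partial>PiM {..<n} ?E)"
    by (simp only: nn_integral_exponential_indicator_le[OF r])
  also have "\<dots> = (\<integral>\<^sup>+x. (\<integral>\<^sup>+y. ennreal (r n) * ennreal (min (sum x {..<n} + y) T - min (sum x {..<n}) T) \<partial>?E n) \<partial>PiM {..<n} ?E)"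
    by (subst nn_integral_cmult) auto
  also have "\<dots> = (\<integral>\<^sup>+x. ennreal (r n) * ennreal (min (sum x {..<Suc n}) T - min (sum x {..<n}) T) \<partial>P)"
    unfolding P by (subst product_nn_integral_insert) (simp_all add: s)
  also have "\<dots> = ennreal (r n) * (\<integral>\<^sup>+x. ennreal (min (sum x {..<Suc n}) T - min (sum x {..<n}) T) \<partial>P)"
    unfolding P by (subst nn_integral_cmult) simp_all
  finally show ?thesis .
qed

declare jump_time.simps(2) [simp del]

lemma holding_time_nonneg: "0 \<le> holding_time X n \<omega>"
proof -
  let ?A = "{u. jump_time X n \<omega> < u \<and> X u \<omega> \<noteq> X (jump_time X n \<omega>) \<omega>}"
  have "jump_time X n \<omega> \<le> Inf ?A" if "?A \<noteq> {}"
    using that by (intro cInf_greatest) auto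
  then show ?thesis by (auto simp: holding_time_def jump_time.simps(2) Let_def)
qed

lemma jump_time_eq_sum: "jump_time X n \<omega> = (\<Sum>i<n. holding_time X i \<omega>)"
proof (induction n)
  case (Suc n)
  have "jump_time X (Suc n) \<omega> = jump_time X n \<omega> + holding_time X n \<omega>"
    by (simp add: holding_time_def)
  with Suc show ?case by simp
qed simp

lemma jump_time_Suc_ge: "jump_time X n \<omega> \<le> jump_time X (Suc n) \<omega>"
  using holding_time_nonneg[of X n \<omega>] by (simp add: holding_time_def)

lemma jump_time_nonneg: "0 \<le> jump_time X n \<omega>"
  unfolding jump_time_eq_sum by (intro sum_nonneg holding_time_nonneg)

section \<open>Joint law of the jump chain and the holding times\<close>

locale finite_ctmc =
  fixes M :: "'w measure" and X :: "real \<Rightarrow> 'w \<Rightarrow> 's" and S :: "'s set"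
    and q :: "'s \<Rightarrow> 's \<Rightarrow> real" and s0 :: 's
  assumes ctmc: "ctmc M X S q s0" and finite_S: "finite S"
    and q_nonneg: "\<And>s s'. s \<in> S \<Longrightarrow> s' \<in> S \<Longrightarrow> s \<noteq> s' \<Longrightarrow> 0 \<le> q s s'"
    and exit_pos: "\<And>s. s \<in> S \<Longrightarrow> 0 < exit_rate S q s"

sublocale finite_ctmc \<subseteq> prob_space M
  using ctmc by (simp add: ctmc_def)

context finite_ctmc
begin

abbreviation "Y \<equiv> jump_chain X"
abbreviation "H \<equiv> holding_time X"
abbreviation "\<tau> \<equiv> jump_time X"

lemma Y_measurable: "Y n \<in> M \<rightarrow>\<^sub>M count_space S"
  using ctmc by (simp add: ctmc_def)

lemma Y_in: "\<omega> \<in> space M \<Longrightarrow> Y n \<omega> \<in> S"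
  using measurable_space[OF Y_measurable] by simp

lemma Y_eq_measurable [measurable]: "Measurable.pred M (\<lambda>\<omega>. Y n \<omega> = y)"
proof -
  have "Y n \<in> M \<rightarrow>\<^sub>M count_space UNIV"
    using Y_measurable by (rule measurable_compose[where f="Y n" and g="\<lambda>x. x", simplified]) simp
  then show ?thesis by measurable
qed

lemma H_measurable [measurable]: "H n \<in> borel_measurable M"
  using ctmc by (simp add: ctmc_def)

lemma tau_measurable [measurable]: "\<tau> n \<in> borel_measurable M"
  unfolding jump_time_eq_sum[abs_def] by measurable

definition path_event :: "nat \<Rightarrow> (nat \<Rightarrow> 's) \<Rightarrow> 'w set" where
  "path_event n y = {\<omega> \<in> space M. \<forall>i\<le>n. Y i \<omega> = y i}"

definition path_weight :: "nat \<Rightarrow> (nat \<Rightarrow> 's) \<Rightarrow> real" where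
  "path_weight n y = (if y 0 = s0 then \<Prod>i<n. jump_prob S q (y i) (y (Suc i)) else 0)"

lemma path_event_measurable [measurable]: "path_event n y \<in> events"
  unfolding path_event_def by measurable

lemma path_event_law:
  assumes "\<And>i. i \<le> n \<Longrightarrow> y i \<in> S" "\<And>i. i < n \<Longrightarrow> 0 \<le> t i"
  shows "prob (path_event n y \<inter> {\<omega> \<in> space M. \<forall>i<n. t i < H i \<omega>}) =
    path_weight n y * (\<Prod>i<n. exp (- exit_rate S q (y i) * t i))"
proof -
  have "path_event n y \<inter> {\<omega> \<in> space M. \<forall>i<n. t i < H i \<omega>} =
      {\<omega> \<in> space M. (\<forall>i\<le>n. Y i \<omega> = y i) \<and> (\<forall>i<n. t i < H i \<omega>)}"
    by (auto simp: path_event_def)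
  moreover have "prob {\<omega> \<in> space M. (\<forall>i\<le>n. Y i \<omega> = y i) \<and> (\<forall>i<n. t i < H i \<omega>)} =
      (if y 0 = s0 then \<Prod>i<n. jump_prob S q (y i) (y (Suc i)) * exp (- exit_rate S q (y i) * t i) else 0)"
    using ctmc assms by (simp add: ctmc_def)
  ultimately show ?thesis by (simp add: path_weight_def prod.distrib)
qed

lemma jump_prob_nonneg: "s \<in> S \<Longrightarrow> s' \<in> S \<Longrightarrow> 0 \<le> jump_prob S q s s'"
  using q_nonneg[of s s'] exit_pos[of s] by (auto simp: jump_prob_def)

lemma sum_jump_prob: "s \<in> S \<Longrightarrow> (\<Sum>s'\<in>S. jump_prob S q s s') = 1"
  using finite_S exit_pos[of s]
  by (simp add: sum.remove[of S s] jump_prob_def sum_divide_distrib[symmetric] exit_rate_def)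

lemma path_weight_nonneg: "(\<And>i. i \<le> n \<Longrightarrow> y i \<in> S) \<Longrightarrow> 0 \<le> path_weight n y"
  by (auto simp: path_weight_def intro!: prod_nonneg jump_prob_nonneg)

lemma path_weight_upd:
  "path_weight (Suc n) (y(Suc n := s')) = path_weight n y * jump_prob S q (y n) s'"
  by (auto simp: path_weight_def)

lemma path_event_upd:
  "path_event (Suc n) (y(Suc n := s')) = path_event n y \<inter> {\<omega> \<in> space M. Y (Suc n) \<omega> = s'}"
  by (auto simp: path_event_def le_Suc_eq)

lemma nn_integral_split_state:
  assumes "f \<in> borel_measurable M"
  shows "(\<integral>\<^sup>+\<omega>. f \<omega> \<partial>M) = (\<Sum>s\<in>S. \<integral>\<^sup>+\<omega>. f \<omega> * indicator {\<omega> \<in> space M. Y n \<omega> = s} \<omega> \<partial>M)"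
  by (rule nn_integral_finite_partition[where c="Y n"]) (use finite_S Y_in assms in auto)

lemma nn_integral_split_path:
  assumes "f \<in> borel_measurable M"
  shows "(\<integral>\<^sup>+\<omega>. f \<omega> \<partial>M) =
    (\<Sum>y\<in>(\<Pi>\<^sub>E i\<in>{..n}. S). \<integral>\<^sup>+\<omega>. f \<omega> * indicator (path_event n y) \<omega> \<partial>M)"
proof (rule nn_integral_finite_partition[where c="\<lambda>\<omega>. \<lambda>i\<in>{..n}. Y i \<omega>"])
  show "finite (\<Pi>\<^sub>E i\<in>{..n}. S)" using finite_S by (intro finite_PiE) auto
  fix \<omega> y assume \<omega>: "\<omega> \<in> space M" and y: "y \<in> (\<Pi>\<^sub>E i\<in>{..n}. S)"
  have "y = (\<lambda>i\<in>{..n}. Y i \<omega>) \<longleftrightarrow> (\<forall>i\<le>n. y i = Y i \<omega>)"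
    using PiE_arb[OF y] by (auto simp: fun_eq_iff restrict_def)
  then show "\<omega> \<in> path_event n y \<longleftrightarrow> y = (\<lambda>i\<in>{..n}. Y i \<omega>)"
    using \<omega> by (auto simp: path_event_def)
next
  fix \<omega> assume "\<omega> \<in> space M"
  then show "(\<lambda>i\<in>{..n}. Y i \<omega>) \<in> (\<Pi>\<^sub>E i\<in>{..n}. S)" using Y_in by simp
qed (simp_all add: assms)

text \<open>A path that stops jumping has holding time \<open>0\<close> by convention, so positivity
  has to come from the law. Taking all thresholds \<open>0\<close> and summing the law of
  \<open>n + 1\<close> jumps over the last state gives the same mass as the law of \<open>n\<close>
  jumps: requiring \<open>0 < H n\<close> in addition costs no probability.\<close>

lemma AE_holding_time_pos: "AE \<omega> in M. 0 < H n \<omega>"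
proof -
  have "AE \<omega> in M. \<forall>i<n. 0 < H i \<omega>" for n
  proof (induction n)
    case (Suc n)
    define B where "B k = {\<omega> \<in> space M. \<forall>i<k. 0 < H i \<omega>}" for k
    have [measurable]: "B k \<in> events" for k unfolding B_def by measurable
    have 1: "emeasure M (path_event n y \<inter> B (Suc n)) = emeasure M (path_event n y \<inter> B n)"
      if y: "y \<in> (\<Pi>\<^sub>E i\<in>{..n}. S)" for y
    proof -
      have yi: "y i \<in> S" if "i \<le> n" for i using y that by auto
      have "emeasure M (path_event n y \<inter> B (Suc n)) = (\<integral>\<^sup>+\<omega>. indicator (path_event n y \<inter> B (Suc n)) \<omega> \<partial>M)"
        by simp
      also have "\<dots> = (\<Sum>s\<in>S. \<integral>\<^sup>+\<omega>. indicator (path_event n y \<inter> B (Suc n)) \<omega> *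
          indicator {\<omega> \<in> space M. Y (Suc n) \<omega> = s} \<omega> \<partial>M)"
        by (rule nn_integral_split_state) measurable
      also have "\<dots> = (\<Sum>s\<in>S. emeasure M (path_event (Suc n) (y(Suc n := s)) \<inter> B (Suc n)))"
      proof (rule sum.cong[OF refl])
        fix s
        have "(\<integral>\<^sup>+\<omega>. indicator (path_event n y \<inter> B (Suc n)) \<omega> * indicator {\<omega> \<in> space M. Y (Suc n) \<omega> = s} \<omega> \<partial>M) =
            (\<integral>\<^sup>+\<omega>. indicator (path_event (Suc n) (y(Suc n := s)) \<inter> B (Suc n)) \<omega> \<partial>M)"
          by (intro nn_integral_cong) (auto simp: path_event_upd indicator_def)
        then show "(\<integral>\<^sup>+\<omega>. indicator (path_event n y \<inter> B (Suc n)) \<omega> * indicator {\<omega> \<in> space M. Y (Suc n) \<omega> = s} \<omega> \<partial>M) =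
            emeasure M (path_event (Suc n) (y(Suc n := s)) \<inter> B (Suc n))" by simp
      qed
      also have "\<dots> = (\<Sum>s\<in>S. ennreal (path_weight n y * jump_prob S q (y n) s))"
      proof (rule sum.cong[OF refl])
        fix s assume "s \<in> S"
        with yi have "(y(Suc n := s)) i \<in> S" if "i \<le> Suc n" for i using that by (auto simp: le_Suc_eq)
        from path_event_law[OF this, where t="\<lambda>_. 0"]
        show "emeasure M (path_event (Suc n) (y(Suc n := s)) \<inter> B (Suc n)) =
            ennreal (path_weight n y * jump_prob S q (y n) s)"
          by (simp add: emeasure_eq_measure B_def path_weight_upd del: fun_upd_apply)
      qed
      also have "\<dots> = ennreal (\<Sum>s\<in>S. path_weight n y * jump_prob S q (y n) s)"
        using yi by (intro sum_ennreal mult_nonneg_nonneg path_weight_nonneg jump_prob_nonneg) auto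
      also have "\<dots> = ennreal (path_weight n y)"
        using yi by (simp add: sum_distrib_left[symmetric] sum_jump_prob)
      also have "\<dots> = emeasure M (path_event n y \<inter> B n)"
        using path_event_law[of n y "\<lambda>_. 0"] yi by (simp add: emeasure_eq_measure B_def)
      finally show ?thesis .
    qed
    have split: "emeasure M (B k) = (\<Sum>y\<in>(\<Pi>\<^sub>E i\<in>{..n}. S). emeasure M (path_event n y \<inter> B k))" for k
    proof -
      have "emeasure M (B k) = (\<integral>\<^sup>+\<omega>. indicator (B k) \<omega> \<partial>M)" by simp
      also have "\<dots> = (\<Sum>y\<in>(\<Pi>\<^sub>E i\<in>{..n}. S). \<integral>\<^sup>+\<omega>. indicator (B k) \<omega> * indicator (path_event n y) \<omega> \<partial>M)"
        by (rule nn_integral_split_path) measurable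
      also have "\<dots> = (\<Sum>y\<in>(\<Pi>\<^sub>E i\<in>{..n}. S). \<integral>\<^sup>+\<omega>. indicator (path_event n y \<inter> B k) \<omega> \<partial>M)"
        by (intro sum.cong refl nn_integral_cong) (auto simp: indicator_def)
      finally show ?thesis by simp
    qed
    have "emeasure M (B (Suc n)) = emeasure M (B n)"
      unfolding split by (intro sum.cong refl 1)
    moreover have "prob (B n) = 1"
      using Suc by (subst prob_eq_1) (auto simp: B_def)
    ultimately have "prob (B (Suc n)) = 1" by (simp add: emeasure_eq_measure)
    then have "AE \<omega> in M. \<omega> \<in> B (Suc n)" by (subst (asm) prob_eq_1) auto
    then show ?case by eventually_elim (auto simp: B_def)
  qed simp
  from this[of "Suc n"] show ?thesis by eventually_elim auto
qed

text \<open>The law speaks of paths only jointly with strict inequalities \<open>t i < H i\<close>;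
  at \<open>t = 0\<close> these hold almost surely.\<close>

lemma prob_path_event:
  assumes "\<And>i. i \<le> n \<Longrightarrow> y i \<in> S"
  shows "prob (path_event n y) = path_weight n y"
proof -
  have "AE \<omega> in M. \<forall>i<n. 0 < H i \<omega>"
    using AE_holding_time_pos by (simp add: AE_all_countable)
  then have "prob (path_event n y) = prob (path_event n y \<inter> {\<omega> \<in> space M. \<forall>i<n. 0 < H i \<omega>})"
    by (intro finite_measure_eq_AE) (auto simp: path_event_def)
  also have "\<dots> = path_weight n y" using path_event_law[of n y "\<lambda>_. 0"] assms by simp
  finally show ?thesis .
qed

text \<open>Given the path, the joint tails factorise. Half-lines form an intersection-stable
  generator of the Borel sets, so this already yields independence, and the single tails identify
  the exponential laws. The path has to include state \<open>Suc n\<close>, because the law of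
  \<open>Suc n\<close> jumps is the one that involves \<open>H n\<close>.\<close>

lemma distr_holding_times:
  assumes y: "\<And>i. i \<le> Suc n \<Longrightarrow> y i \<in> S" and pos: "0 < prob (path_event (Suc n) y)"
  shows "distr (uniform_measure M (path_event (Suc n) y)) (PiM {..n} (\<lambda>_. borel)) (\<lambda>\<omega>. \<lambda>i\<in>{..n}. H i \<omega>) =
    PiM {..n} (\<lambda>i. density lborel (exponential_density (exit_rate S q (y i))))"
proof -
  let ?A = "path_event (Suc n) y" and ?r = "\<lambda>i. exit_rate S q (y i)"
  define N where "N = uniform_measure M ?A"
  have A: "emeasure M ?A \<noteq> 0" "emeasure M ?A \<noteq> \<infinity>"
    using pos by (auto simp: emeasure_eq_measure)
  interpret N: prob_space N unfolding N_def by (rule prob_space_uniform_measure[OF A])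
  have sets_N [measurable_cong]: "sets N = sets M" by (simp add: N_def)
  have space_N: "space N = space M" using sets_N by (rule sets_eq_imp_space_eq)
  have H_N [measurable]: "H i \<in> borel_measurable N" for i
    by (simp add: measurable_cong_sets[OF sets_N refl])
  have r: "0 < ?r i" if "i \<le> n" for i using exit_pos y that by simp
  have w: "prob ?A = path_weight (Suc n) y" by (rule prob_path_event[OF y])
  have "AE \<omega> in M. \<forall>i. 0 < H i \<omega>" using AE_holding_time_pos by (simp add: AE_all_countable)
  then have H_pos: "AE \<omega> in N. \<forall>i. 0 < H i \<omega>"
    unfolding N_def by (intro AE_uniform_measureI) auto
  have tail: "N.prob {\<omega> \<in> space N. \<forall>j\<in>J. a j < H j \<omega>} = (\<Prod>j\<in>J. exp (- ?r j * max 0 (a j)))"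
    if J: "J \<subseteq> {..n}" for J a
  proof -
    \<comment> \<open>The law needs a nonnegative threshold for every index. Negative thresholds and
      those outside \<open>J\<close> are replaced by \<open>0\<close>, which changes the event by a
      null set.\<close>
    define t where "t j = (if j \<in> J then max 0 (a j) else 0)" for j
    have "N.prob {\<omega> \<in> space N. \<forall>j\<in>J. a j < H j \<omega>} = N.prob {\<omega> \<in> space N. \<forall>i<Suc n. t i < H i \<omega>}"
    proof (rule N.finite_measure_eq_AE)
      show "AE \<omega> in N. \<omega> \<in> {\<omega> \<in> space N. \<forall>j\<in>J. a j < H j \<omega>} \<longleftrightarrow> \<omega> \<in> {\<omega> \<in> space N. \<forall>i<Suc n. t i < H i \<omega>}"
        using H_pos
      proof eventually_elim
        case (elim \<omega>)
        have "(\<forall>j\<in>J. a j < H j \<omega>) \<longleftrightarrow> (\<forall>i<Suc n. t i < H i \<omega>)"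
          using elim J by (auto simp: t_def subset_iff less_Suc_eq_le)
        then show ?case by simp
      qed
      have "finite J" using J by (rule finite_subset) simp
      then show "{\<omega> \<in> space N. \<forall>j\<in>J. a j < H j \<omega>} \<in> N.events" by measurable
    qed measurable
    also have "\<dots> = prob (?A \<inter> {\<omega> \<in> space M. \<forall>i<Suc n. t i < H i \<omega>}) / prob ?A"
      unfolding space_N unfolding N_def by (intro measure_uniform_measure A) measurable
    also have "\<dots> = (\<Prod>i<Suc n. exp (- ?r i * t i))"
      using path_event_law[OF y, where n="Suc n" and t=t] pos unfolding w by (simp add: t_def)
    also have "\<dots> = (\<Prod>j\<in>J. exp (- ?r j * max 0 (a j)))"
      using J by (intro prod.mono_neutral_cong_right) (auto simp: t_def)
    finally show ?thesis .
  qed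
  have tail1: "N.prob {\<omega> \<in> space N. a < H i \<omega>} = exp (- ?r i * max 0 a)" if "i \<le> n" for i a
    using tail[of "{i}" "\<lambda>_. a"] that by simp
  let ?F = "\<lambda>i. {H i -` B \<inter> space N |B. B \<in> range greaterThan}"
  have "N.indep_sets ?F {..n}"
  proof (rule N.indep_setsI)
    fix i assume "i \<in> {..n}" then show "?F i \<subseteq> N.events" by auto
  next
    fix B J assume J: "J \<noteq> {}" "J \<subseteq> {..n}" "finite J" and B: "\<forall>j\<in>J. B j \<in> ?F j"
    have "\<exists>a. B j = {\<omega> \<in> space N. a < H j \<omega>}" if j: "j \<in> J" for j
    proof -
      from B j obtain a where "B j = H j -` {a<..} \<inter> space N" by auto
      then show ?thesis by (intro exI[of _ a]) auto
    qed
    then obtain a where a: "\<And>j. j \<in> J \<Longrightarrow> B j = {\<omega> \<in> space N. a j < H j \<omega>}" by metis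
    have "(\<Inter>j\<in>J. B j) = {\<omega> \<in> space N. \<forall>j\<in>J. a j < H j \<omega>}" using a J by auto
    then have "N.prob (\<Inter>j\<in>J. B j) = (\<Prod>j\<in>J. exp (- ?r j * max 0 (a j)))" using tail[OF J(2)] by simp
    also have "\<dots> = (\<Prod>j\<in>J. N.prob (B j))" using J a tail1 by (intro prod.cong) auto
    finally show "N.prob (\<Inter>j\<in>J. B j) = (\<Prod>j\<in>J. N.prob (B j))" .
  qed
  then have "N.indep_sets (\<lambda>i. sigma_sets (space N) (?F i)) {..n}"
  proof (rule N.indep_sets_sigma)
    fix i
    show "Int_stable (?F i)"
    proof (rule Int_stableI)
      fix U V assume "U \<in> ?F i" "V \<in> ?F i"
      then obtain a b where "U = H i -` {a<..} \<inter> space N" "V = H i -` {b<..} \<inter> space N" by auto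
      then have "U \<inter> V = H i -` {max a b<..} \<inter> space N" by auto
      then show "U \<inter> V \<in> ?F i" by auto
    qed
  qed
  moreover have "sigma_sets (space N) (?F i) = {H i -` B \<inter> space N |B. B \<in> sets borel}" for i
    by (subst sigma_sets_vimage_commute[symmetric]) (auto simp: borel_Ioi)
  ultimately have "N.indep_vars (\<lambda>_. borel) H {..n}"
    by (simp add: N.indep_vars_def2)
  then have "distr N (PiM {..n} (\<lambda>_. borel)) (\<lambda>\<omega>. \<lambda>i\<in>{..n}. H i \<omega>) = PiM {..n} (\<lambda>i. distr N borel (H i))"
    by (subst (asm) N.indep_vars_iff_distr_eq_PiM') auto
  also have "\<dots> = PiM {..n} (\<lambda>i. density lborel (exponential_density (?r i)))"
  proof (rule PiM_cong[OF refl])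
    fix i assume "i \<in> {..n}"
    then have i: "i \<le> n" by simp
    have "N.prob {\<omega> \<in> space N. H i \<omega> \<le> a} = 1 - exp (- a * ?r i)" if "0 \<le> a" for a
    proof -
      have "{\<omega> \<in> space N. H i \<omega> \<le> a} = space N - {\<omega> \<in> space N. a < H i \<omega>}" by auto
      then have "N.prob {\<omega> \<in> space N. H i \<omega> \<le> a} = 1 - N.prob {\<omega> \<in> space N. a < H i \<omega>}"
        by (simp add: N.prob_compl)
      with tail1[OF i] that show ?thesis by (simp add: max_def mult.commute)
    qed
    then have "distributed N lborel (H i) (exponential_density (?r i))"
      using r[OF i] by (simp add: N.exponential_distributed_iff)
    then show "distr N borel (H i) = density lborel (exponential_density (?r i))"
      using distributed_distr_eq_density by (metis (no_types, lifting) distr_cong sets_lborel)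
  qed
  finally show ?thesis unfolding N_def .
qed

text \<open>Removes the conditioning, so that paths of probability \<open>0\<close>, where both
  sides vanish, need no separate treatment in later sums over paths.\<close>

lemma nn_integral_holding_times:
  assumes y: "\<And>i. i \<le> Suc n \<Longrightarrow> y i \<in> S"
    and f: "f \<in> borel_measurable (PiM {..n} (\<lambda>_. borel :: real measure))"
  shows "(\<integral>\<^sup>+\<omega>. f (\<lambda>i\<in>{..n}. H i \<omega>) * indicator (path_event (Suc n) y) \<omega> \<partial>M) =
    ennreal (path_weight (Suc n) y) *
    (\<integral>\<^sup>+x. f x \<partial>PiM {..n} (\<lambda>i. density lborel (exponential_density (exit_rate S q (y i)))))"
proof -
  let ?A = "path_event (Suc n) y"
  have w: "emeasure M ?A = ennreal (path_weight (Suc n) y)"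
    using prob_path_event[OF y] by (simp add: emeasure_eq_measure)
  have [measurable]: "(\<lambda>\<omega>. \<lambda>i\<in>{..n}. H i \<omega>) \<in> M \<rightarrow>\<^sub>M PiM {..n} (\<lambda>_. borel)"
    by measurable
  have fm [measurable]: "(\<lambda>\<omega>. f (\<lambda>i\<in>{..n}. H i \<omega>)) \<in> borel_measurable M"
    using f by (rule measurable_compose[rotated]) measurable
  show ?thesis
  proof (cases "prob ?A = 0")
    case True
    then have "emeasure M ?A = 0" by (simp add: emeasure_eq_measure)
    then have "(\<integral>\<^sup>+\<omega>. f (\<lambda>i\<in>{..n}. H i \<omega>) * indicator ?A \<omega> \<partial>M) = 0"
      by (intro nn_integral_null_set) auto
    with \<open>emeasure M ?A = 0\<close> show ?thesis unfolding w[symmetric] by simp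
  next
    case False
    then have pos: "0 < prob ?A" by (simp add: zero_less_measure_iff)
    have "(\<integral>\<^sup>+x. f x \<partial>PiM {..n} (\<lambda>i. density lborel (exponential_density (exit_rate S q (y i))))) =
        (\<integral>\<^sup>+\<omega>. f (\<lambda>i\<in>{..n}. H i \<omega>) \<partial>uniform_measure M ?A)"
      using f by (subst distr_holding_times[OF y pos, symmetric], simp) (subst nn_integral_distr, auto)
    also have "\<dots> = (\<integral>\<^sup>+\<omega>. f (\<lambda>i\<in>{..n}. H i \<omega>) * indicator ?A \<omega> \<partial>M) / emeasure M ?A"
      by (rule nn_integral_uniform_measure) measurable
    finally show ?thesis
      using pos unfolding w[symmetric] emeasure_eq_measure
      by (simp only: ennreal_times_divide mult.commute[of "ennreal (prob ?A)"])
        (simp add: ennreal_mult_divide_eq)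
  qed
qed

text \<open>The difference of the two minima is the part of the \<open>n\<close>-th sojourn that
  lies before \<open>T\<close>. On a fixed path the next state contributes only the factor
  \<open>jump_prob\<close>, and the exponential identity trades the event that the sojourn ends by
  \<open>T\<close> for the exit rate times this part; summing over paths gives the claim.\<close>

lemma nn_integral_transition:
  assumes s: "s \<in> S" "s' \<in> S"
  shows "(\<integral>\<^sup>+\<omega>. indicator {\<omega> \<in> space M. Y n \<omega> = s \<and> Y (Suc n) \<omega> = s' \<and> \<tau> (Suc n) \<omega> \<le> T} \<omega> \<partial>M) =
    ennreal (jump_prob S q s s' * exit_rate S q s) *
    (\<integral>\<^sup>+\<omega>. ennreal (min (\<tau> (Suc n) \<omega>) T - min (\<tau> n \<omega>) T) * indicator {\<omega> \<in> space M. Y n \<omega> = s} \<omega> \<partial>M)"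
proof -
  let ?P = "\<Pi>\<^sub>E i\<in>{..n}. S"
  let ?E = "\<lambda>y. PiM {..n} (\<lambda>i. density lborel (exponential_density (exit_rate S q (y i))))"
  let ?f = "\<lambda>x :: nat \<Rightarrow> real. indicator {..T} (sum x {..<Suc n}) :: ennreal"
  let ?g = "\<lambda>x :: nat \<Rightarrow> real. ennreal (min (sum x {..<Suc n}) T - min (sum x {..<n}) T)"
  let ?h = "\<lambda>\<omega>. \<lambda>i\<in>{..n}. H i \<omega>"
  have m: "(\<lambda>x. sum x {..<k}) \<in> borel_measurable (PiM {..n} (\<lambda>_. borel :: real measure))" if "k \<le> Suc n" for k
    using that by (intro borel_measurable_sum measurable_component_singleton) auto
  note [measurable] = m[OF order_refl] m[of n]
  have fm: "?f \<in> borel_measurable (PiM {..n} (\<lambda>_. borel))" "?g \<in> borel_measurable (PiM {..n} (\<lambda>_. borel))"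
    by measurable
  have \<tau>: "sum (?h \<omega>) {..<k} = \<tau> k \<omega>" if "k \<le> Suc n" for k \<omega>
    unfolding jump_time_eq_sum using that by (intro sum.cong) auto
  have path: "(\<integral>\<^sup>+\<omega>. F (?h \<omega>) * indicator (path_event (Suc n) (y(Suc n := u))) \<omega> \<partial>M) =
      ennreal (path_weight n y * jump_prob S q (y n) u) * (\<integral>\<^sup>+x. F x \<partial>?E y)"
    if y: "y \<in> ?P" and u: "u \<in> S" and F: "F \<in> borel_measurable (PiM {..n} (\<lambda>_. borel))" for y u F
  proof -
    have "(y(Suc n := u)) i \<in> S" if "i \<le> Suc n" for i
      using y u that by (auto simp: le_Suc_eq)
    from nn_integral_holding_times[OF this F]
    have "(\<integral>\<^sup>+\<omega>. F (?h \<omega>) * indicator (path_event (Suc n) (y(Suc n := u))) \<omega> \<partial>M) =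
        ennreal (path_weight n y * jump_prob S q (y n) u) * (\<integral>\<^sup>+x. F x \<partial>?E (y(Suc n := u)))"
      by (simp add: path_weight_upd del: fun_upd_apply)
    also have "?E (y(Suc n := u)) = ?E y" by (intro PiM_cong) auto
    finally show ?thesis .
  qed
  have key: "(\<integral>\<^sup>+x. ?f x \<partial>?E y) = ennreal (exit_rate S q (y n)) * (\<integral>\<^sup>+x. ?g x \<partial>?E y)" if y: "y \<in> ?P" for y
  proof -
    define r where "r i = (if i \<le> n then exit_rate S q (y i) else 1)" for i
    have "0 < r i" for i using exit_pos y by (auto simp: r_def)
    from nn_integral_PiM_exponential_indicator_le[OF this, where T=T and n=n]
    have "(\<integral>\<^sup>+x. ?f x \<partial>PiM {..n} (\<lambda>i. density lborel (exponential_density (r i)))) =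
      ennreal (r n) * (\<integral>\<^sup>+x. ?g x \<partial>PiM {..n} (\<lambda>i. density lborel (exponential_density (r i))))" .
    moreover have "PiM {..n} (\<lambda>i. density lborel (exponential_density (r i))) = ?E y"
      by (intro PiM_cong) (auto simp: r_def)
    ultimately show ?thesis by (simp add: r_def)
  qed
  \<comment> \<open>\<open>nn_integral_holding_times\<close> requires the state after the
    \<open>n\<close>-th sojourn to be fixed as well. It is summed out again here, the jump
    probabilities adding up to \<open>1\<close>.\<close>
  have g: "(\<integral>\<^sup>+\<omega>. ?g (?h \<omega>) * indicator (path_event n y) \<omega> \<partial>M) = ennreal (path_weight n y) * (\<integral>\<^sup>+x. ?g x \<partial>?E y)"
    if y: "y \<in> ?P" for y
  proof -
    have yn: "y n \<in> S" using y by auto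
    have w: "0 \<le> path_weight n y" using y by (intro path_weight_nonneg) auto
    have "(\<integral>\<^sup>+\<omega>. ?g (?h \<omega>) * indicator (path_event n y) \<omega> \<partial>M) =
        (\<Sum>u\<in>S. \<integral>\<^sup>+\<omega>. ?g (?h \<omega>) * indicator (path_event n y) \<omega> * indicator {\<omega> \<in> space M. Y (Suc n) \<omega> = u} \<omega> \<partial>M)"
      by (rule nn_integral_split_state) (simp add: \<tau>)
    also have "\<dots> = (\<Sum>u\<in>S. \<integral>\<^sup>+\<omega>. ?g (?h \<omega>) * indicator (path_event (Suc n) (y(Suc n := u))) \<omega> \<partial>M)"
      by (intro sum.cong refl nn_integral_cong) (auto simp: path_event_upd indicator_def)
    also have "\<dots> = (\<Sum>u\<in>S. ennreal (path_weight n y * jump_prob S q (y n) u) * (\<integral>\<^sup>+x. ?g x \<partial>?E y))"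
      using y fm by (intro sum.cong refl path)
    also have "\<dots> = (\<Sum>u\<in>S. ennreal (path_weight n y * jump_prob S q (y n) u)) * (\<integral>\<^sup>+x. ?g x \<partial>?E y)"
      by (simp add: sum_distrib_right)
    also have "(\<Sum>u\<in>S. ennreal (path_weight n y * jump_prob S q (y n) u)) = ennreal (\<Sum>u\<in>S. path_weight n y * jump_prob S q (y n) u)"
      using yn w by (intro sum_ennreal mult_nonneg_nonneg jump_prob_nonneg)
    also have "(\<Sum>u\<in>S. path_weight n y * jump_prob S q (y n) u) = path_weight n y"
      using yn by (simp add: sum_distrib_left[symmetric] sum_jump_prob)
    finally show ?thesis .
  qed
  let ?L = "{\<omega> \<in> space M. Y n \<omega> = s \<and> Y (Suc n) \<omega> = s' \<and> \<tau> (Suc n) \<omega> \<le> T}"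
  have "(\<integral>\<^sup>+\<omega>. indicator ?L \<omega> \<partial>M) = (\<Sum>y\<in>?P. \<integral>\<^sup>+\<omega>. indicator ?L \<omega> * indicator (path_event n y) \<omega> \<partial>M)"
    by (rule nn_integral_split_path) measurable
  also have "\<dots> = (\<Sum>y\<in>?P. ennreal (jump_prob S q s s' * exit_rate S q s) * (\<integral>\<^sup>+\<omega>. ennreal (min (\<tau> (Suc n) \<omega>) T - min (\<tau> n \<omega>) T) *
      indicator {\<omega> \<in> space M. Y n \<omega> = s} \<omega> * indicator (path_event n y) \<omega> \<partial>M))"
  proof (rule sum.cong[OF refl])
    fix y assume y: "y \<in> ?P"
    have w: "0 \<le> path_weight n y" using y by (intro path_weight_nonneg) auto
    show "(\<integral>\<^sup>+\<omega>. indicator ?L \<omega> * indicator (path_event n y) \<omega> \<partial>M) =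
        ennreal (jump_prob S q s s' * exit_rate S q s) * (\<integral>\<^sup>+\<omega>. ennreal (min (\<tau> (Suc n) \<omega>) T - min (\<tau> n \<omega>) T) *
        indicator {\<omega> \<in> space M. Y n \<omega> = s} \<omega> * indicator (path_event n y) \<omega> \<partial>M)"
    proof (cases "y n = s")
      case False
      have "(\<integral>\<^sup>+\<omega>. indicator ?L \<omega> * indicator (path_event n y) \<omega> \<partial>M) = (\<integral>\<^sup>+\<omega>. 0 \<partial>M)"
        using False by (intro nn_integral_cong) (auto simp: path_event_def indicator_def)
      moreover have "(\<integral>\<^sup>+\<omega>. ennreal (min (\<tau> (Suc n) \<omega>) T - min (\<tau> n \<omega>) T) *
          indicator {\<omega> \<in> space M. Y n \<omega> = s} \<omega> * indicator (path_event n y) \<omega> \<partial>M) = (\<integral>\<^sup>+\<omega>. 0 \<partial>M)"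
        using False by (intro nn_integral_cong) (auto simp: path_event_def indicator_def)
      ultimately show ?thesis by simp
    next
      case True
      have "(\<integral>\<^sup>+\<omega>. indicator ?L \<omega> * indicator (path_event n y) \<omega> \<partial>M) =
          (\<integral>\<^sup>+\<omega>. ?f (?h \<omega>) * indicator (path_event (Suc n) (y(Suc n := s'))) \<omega> \<partial>M)"
        unfolding \<tau>[OF order_refl] using True
        by (intro nn_integral_cong) (auto simp: path_event_def le_Suc_eq indicator_def simp del: sum.lessThan_Suc)
      also have "\<dots> = ennreal (path_weight n y * jump_prob S q s s') *
          (ennreal (exit_rate S q s) * (\<integral>\<^sup>+x. ?g x \<partial>?E y))"
        unfolding path[OF y s(2) fm(1)] key[OF y] True ..
      also have "\<dots> = ennreal (path_weight n y * jump_prob S q s s' * exit_rate S q s) * (\<integral>\<^sup>+x. ?g x \<partial>?E y)"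
        using w exit_pos[OF s(1)] jump_prob_nonneg[OF s]
        by (subst ennreal_mult) (auto simp: mult.assoc)
      also have "path_weight n y * jump_prob S q s s' * exit_rate S q s = jump_prob S q s s' * exit_rate S q s * path_weight n y"
        by simp
      also have "ennreal (jump_prob S q s s' * exit_rate S q s * path_weight n y) * (\<integral>\<^sup>+x. ?g x \<partial>?E y) =
          ennreal (jump_prob S q s s' * exit_rate S q s) * (\<integral>\<^sup>+\<omega>. ?g (?h \<omega>) * indicator (path_event n y) \<omega> \<partial>M)"
        using w exit_pos[OF s(1)] jump_prob_nonneg[OF s] unfolding g[OF y]
        by (subst ennreal_mult) (auto simp: mult.assoc)
      also have "(\<integral>\<^sup>+\<omega>. ?g (?h \<omega>) * indicator (path_event n y) \<omega> \<partial>M) =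
          (\<integral>\<^sup>+\<omega>. ennreal (min (\<tau> (Suc n) \<omega>) T - min (\<tau> n \<omega>) T) *
          indicator {\<omega> \<in> space M. Y n \<omega> = s} \<omega> * indicator (path_event n y) \<omega> \<partial>M)"
        unfolding \<tau>[OF order_refl] \<tau>[OF le_SucI[OF order_refl]]
        using True by (intro nn_integral_cong) (auto simp: path_event_def indicator_def)
      finally show ?thesis .
    qed
  qed
  also have "\<dots> = ennreal (jump_prob S q s s' * exit_rate S q s) * (\<integral>\<^sup>+\<omega>. ennreal (min (\<tau> (Suc n) \<omega>) T - min (\<tau> n \<omega>) T) *
      indicator {\<omega> \<in> space M. Y n \<omega> = s} \<omega> \<partial>M)"
    unfolding sum_distrib_left[symmetric]
    by (subst nn_integral_split_path[symmetric]) simp_all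
  finally show ?thesis .
qed

section \<open>Dynkin's formula and the long-run average\<close>

lemma jump_indicator_measurable:
  "(\<lambda>\<omega>. indicator {..T} (\<tau> (Suc n) \<omega>) * f (Y n \<omega>) (Y (Suc n) \<omega>) :: real) \<in> borel_measurable M"
proof -
  have "(\<lambda>\<omega>. (Y n \<omega>, Y (Suc n) \<omega>)) \<in> M \<rightarrow>\<^sub>M count_space (S \<times> S)"
    using measurable_Pair[OF Y_measurable Y_measurable] finite_S
    by (simp add: pair_measure_countable countable_finite)
  then have "(\<lambda>\<omega>. case (Y n \<omega>, Y (Suc n) \<omega>) of (x, y) \<Rightarrow> f x y) \<in> borel_measurable M"
    by (rule measurable_compose) simp
  then show ?thesis by simp
qed

definition sum_abs :: "('s \<Rightarrow> 's \<Rightarrow> real) \<Rightarrow> real" where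
  "sum_abs f = (\<Sum>s\<in>S. \<Sum>s'\<in>S. \<bar>f s s'\<bar>)"

lemma abs_le_sum_abs: "s \<in> S \<Longrightarrow> s' \<in> S \<Longrightarrow> \<bar>f s s'\<bar> \<le> sum_abs f"
  unfolding sum_abs_def
  by (rule order_trans[OF member_le_sum[of s' S "\<lambda>s'. \<bar>f s s'\<bar>"]
    member_le_sum[of s S "\<lambda>s. \<Sum>s'\<in>S. \<bar>f s s'\<bar>"]]) (auto simp: finite_S intro: sum_nonneg)

lemma sum_abs_nonneg: "0 \<le> sum_abs f"
  unfolding sum_abs_def by (intro sum_nonneg) simp

lemma jump_indicator_integrable:
  "integrable M (\<lambda>\<omega>. indicator {..T} (\<tau> (Suc n) \<omega>) * f (Y n \<omega>) (Y (Suc n) \<omega>) :: real)"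
  by (rule integrable_const_bound[of _ "sum_abs f"])
    (use abs_le_sum_abs sum_abs_nonneg jump_indicator_measurable Y_in in \<open>auto simp: indicator_def intro!: AE_I2\<close>)

text \<open>The compensator identity for a single jump: \<open>nn_integral_transition\<close> is
  summed over all pairs of states, and \<open>jump_prob\<close> times the exit rate is the rate
  \<open>q\<close> off the diagonal and \<open>0\<close> on it.\<close>

lemma expectation_jump:
  assumes T: "0 \<le> T"
  shows "expectation (\<lambda>\<omega>. indicator {..T} (\<tau> (Suc n) \<omega>) * f (Y n \<omega>) (Y (Suc n) \<omega>)) =
    expectation (\<lambda>\<omega>. (min (\<tau> (Suc n) \<omega>) T - min (\<tau> n \<omega>) T) *
      (\<Sum>s'\<in>S - {Y n \<omega>}. q (Y n \<omega>) s' * f (Y n \<omega>) s'))"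
proof -
  let ?D = "\<lambda>\<omega>. min (\<tau> (Suc n) \<omega>) T - min (\<tau> n \<omega>) T"
  let ?L = "\<lambda>s s'. {\<omega> \<in> space M. Y n \<omega> = s \<and> Y (Suc n) \<omega> = s' \<and> \<tau> (Suc n) \<omega> \<le> T}"
  let ?B = "\<lambda>s. {\<omega> \<in> space M. Y n \<omega> = s}"
  let ?e = "\<lambda>s. expectation (\<lambda>\<omega>. ?D \<omega> * indicator (?B s) \<omega>)"
  have D: "0 \<le> ?D \<omega>" "?D \<omega> \<le> T" for \<omega>
    using jump_time_Suc_ge[of X n \<omega>] jump_time_nonneg[of X n \<omega>] T by auto
  have Dint: "integrable M (\<lambda>\<omega>. ?D \<omega> * indicator (?B s) \<omega>)" for s
    by (rule integrable_const_bound[of _ T]) (use D T in \<open>auto simp: indicator_def\<close>)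
  have pL: "prob (?L s s') = jump_prob S q s s' * exit_rate S q s * ?e s" if s: "s \<in> S" "s' \<in> S" for s s'
  proof -
    have "ennreal (prob (?L s s')) = (\<integral>\<^sup>+\<omega>. indicator (?L s s') \<omega> \<partial>M)"
      by (simp add: emeasure_eq_measure)
    also have "\<dots> = ennreal (jump_prob S q s s' * exit_rate S q s) * (\<integral>\<^sup>+\<omega>. ennreal (?D \<omega>) * indicator (?B s) \<omega> \<partial>M)"
      by (rule nn_integral_transition[OF s])
    also have "(\<integral>\<^sup>+\<omega>. ennreal (?D \<omega>) * indicator (?B s) \<omega> \<partial>M) = (\<integral>\<^sup>+\<omega>. ennreal (?D \<omega> * indicator (?B s) \<omega>) \<partial>M)"
      by (intro nn_integral_cong) (simp add: indicator_def)
    also have "\<dots> = ennreal (?e s)"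
      using D by (intro nn_integral_eq_integral Dint AE_I2) (simp add: indicator_def)
    also have "ennreal (jump_prob S q s s' * exit_rate S q s) * ennreal (?e s) =
        ennreal (jump_prob S q s s' * exit_rate S q s * ?e s)"
      using jump_prob_nonneg[OF s] exit_pos[OF s(1)] by (simp add: ennreal_mult')
    finally show ?thesis
      using jump_prob_nonneg[OF s] exit_pos[OF s(1)] D
      by (subst (asm) ennreal_inj) (auto intro!: mult_nonneg_nonneg Bochner_Integration.integral_nonneg simp: indicator_def)
  qed
  have "expectation (\<lambda>\<omega>. indicator {..T} (\<tau> (Suc n) \<omega>) * f (Y n \<omega>) (Y (Suc n) \<omega>)) =
      expectation (\<lambda>\<omega>. \<Sum>s\<in>S. \<Sum>s'\<in>S. f s s' * indicator (?L s s') \<omega>)"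
  proof (rule Bochner_Integration.integral_cong[OF refl])
    fix \<omega> assume \<omega>: "\<omega> \<in> space M"
    have "(\<Sum>s\<in>S. \<Sum>s'\<in>S. f s s' * indicator (?L s s') \<omega>) =
        (\<Sum>s\<in>S. if Y n \<omega> = s then (\<Sum>s'\<in>S. if Y (Suc n) \<omega> = s' then f s s' * indicator {..T} (\<tau> (Suc n) \<omega>) else 0) else 0)"
      using \<omega> by (intro sum.cong refl) (auto intro!: sum.cong sum.neutral simp: indicator_def)
    also have "\<dots> = indicator {..T} (\<tau> (Suc n) \<omega>) * f (Y n \<omega>) (Y (Suc n) \<omega>)"
      using Y_in[OF \<omega>] finite_S by simp
    finally show "indicator {..T} (\<tau> (Suc n) \<omega>) * f (Y n \<omega>) (Y (Suc n) \<omega>) =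
        (\<Sum>s\<in>S. \<Sum>s'\<in>S. f s s' * indicator (?L s s') \<omega>)" by simp
  qed
  also have "\<dots> = (\<Sum>s\<in>S. \<Sum>s'\<in>S. f s s' * prob (?L s s'))"
  proof -
    have L: "?L s s' \<in> events" for s s' by measurable
    have "integrable M (\<lambda>\<omega>. f s s' * indicator (?L s s') \<omega>)" for s s'
      using L by (intro integrable_mult_right integrable_real_indicator) (auto simp: emeasure_eq_measure)
    moreover have "expectation (\<lambda>\<omega>. f s s' * indicator (?L s s') \<omega>) = f s s' * prob (?L s s')" for s s'
      using L[of s s'] by (subst integral_mult_right_zero) (simp add: Int_absorb1)
    ultimately show ?thesis
      by (simp only: Bochner_Integration.integral_sum Bochner_Integration.integrable_sum)
  qed
  also have "\<dots> = (\<Sum>s\<in>S. ?e s * (\<Sum>s'\<in>S - {s}. q s s' * f s s'))"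
  proof (rule sum.cong[OF refl])
    fix s assume s: "s \<in> S"
    have "(\<Sum>s'\<in>S. f s s' * prob (?L s s')) = (\<Sum>s'\<in>S. ?e s * (jump_prob S q s s' * exit_rate S q s * f s s'))"
      using s by (intro sum.cong refl) (simp add: pL)
    also have "\<dots> = ?e s * (\<Sum>s'\<in>S. jump_prob S q s s' * exit_rate S q s * f s s')"
      by (simp add: sum_distrib_left)
    also have "(\<Sum>s'\<in>S. jump_prob S q s s' * exit_rate S q s * f s s') = (\<Sum>s'\<in>S - {s}. q s s' * f s s')"
      using s exit_pos[OF s] finite_S
      by (intro sum.mono_neutral_cong_right) (auto simp: jump_prob_def)
    finally show "(\<Sum>s'\<in>S. f s s' * prob (?L s s')) = ?e s * (\<Sum>s'\<in>S - {s}. q s s' * f s s')" .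
  qed
  also have "\<dots> = (\<Sum>s\<in>S. expectation (\<lambda>\<omega>. ?D \<omega> * indicator (?B s) \<omega> * (\<Sum>s'\<in>S - {s}. q s s' * f s s')))"
    by simp
  also have "\<dots> = expectation (\<lambda>\<omega>. \<Sum>s\<in>S. ?D \<omega> * indicator (?B s) \<omega> * (\<Sum>s'\<in>S - {s}. q s s' * f s s'))"
    by (intro Bochner_Integration.integral_sum[symmetric] integrable_mult_left Dint)
  also have "\<dots> = expectation (\<lambda>\<omega>. ?D \<omega> * (\<Sum>s'\<in>S - {Y n \<omega>}. q (Y n \<omega>) s' * f (Y n \<omega>) s'))"
  proof (rule Bochner_Integration.integral_cong[OF refl])
    fix \<omega> assume \<omega>: "\<omega> \<in> space M"
    have "(\<Sum>s\<in>S. ?D \<omega> * indicator (?B s) \<omega> * (\<Sum>s'\<in>S - {s}. q s s' * f s s')) =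
        (\<Sum>s\<in>S. if Y n \<omega> = s then ?D \<omega> * (\<Sum>s'\<in>S - {s}. q s s' * f s s') else 0)"
      using \<omega> by (intro sum.cong refl) auto
    then show "(\<Sum>s\<in>S. ?D \<omega> * indicator (?B s) \<omega> * (\<Sum>s'\<in>S - {s}. q s s' * f s s')) =
        ?D \<omega> * (\<Sum>s'\<in>S - {Y n \<omega>}. q (Y n \<omega>) s' * f (Y n \<omega>) s')"
      using Y_in[OF \<omega>] finite_S by simp
  qed
  finally show ?thesis .
qed

lemma integrable_min_jump_time: "0 \<le> T \<Longrightarrow> integrable M (\<lambda>\<omega>. min (\<tau> n \<omega>) T)"
  by (rule integrable_const_bound[of _ T]) (use jump_time_nonneg[of X n] in auto)

text \<open>With a constant compensator rate \<open>g\<close>, the contributions of the single jumps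
  are \<open>g\<close> times the expected sojourn parts before \<open>T\<close>, and these
  telescope.\<close>

lemma dynkin:
  assumes T: "0 \<le> T" and f: "\<And>s. s \<in> S \<Longrightarrow> (\<Sum>s'\<in>S - {s}. q s s' * f s s') = g"
  shows "(\<Sum>n<m. expectation (\<lambda>\<omega>. indicator {..T} (\<tau> (Suc n) \<omega>) * f (Y n \<omega>) (Y (Suc n) \<omega>))) =
    g * expectation (\<lambda>\<omega>. min (\<tau> m \<omega>) T)"
proof -
  have "expectation (\<lambda>\<omega>. indicator {..T} (\<tau> (Suc n) \<omega>) * f (Y n \<omega>) (Y (Suc n) \<omega>)) =
      g * expectation (\<lambda>\<omega>. min (\<tau> (Suc n) \<omega>) T) - g * expectation (\<lambda>\<omega>. min (\<tau> n \<omega>) T)" for n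
  proof -
    have "expectation (\<lambda>\<omega>. indicator {..T} (\<tau> (Suc n) \<omega>) * f (Y n \<omega>) (Y (Suc n) \<omega>)) =
        expectation (\<lambda>\<omega>. (min (\<tau> (Suc n) \<omega>) T - min (\<tau> n \<omega>) T) * g)"
      unfolding expectation_jump[OF T] using Y_in f
      by (intro Bochner_Integration.integral_cong) auto
    then show ?thesis
      using integrable_min_jump_time[OF T] by (simp add: algebra_simps)
  qed
  then have "(\<Sum>n<m. expectation (\<lambda>\<omega>. indicator {..T} (\<tau> (Suc n) \<omega>) * f (Y n \<omega>) (Y (Suc n) \<omega>))) =
      (\<Sum>n<m. g * expectation (\<lambda>\<omega>. min (\<tau> (Suc n) \<omega>) T) - g * expectation (\<lambda>\<omega>. min (\<tau> n \<omega>) T))"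
    by simp
  also have "\<dots> = g * expectation (\<lambda>\<omega>. min (\<tau> m \<omega>) T) - g * expectation (\<lambda>\<omega>. min (\<tau> 0 \<omega>) T)"
    by (rule sum_lessThan_telescope)
  finally show ?thesis using T by simp
qed

text \<open>Non-explosion from Dynkin's formula itself: the reward \<open>1 / exit_rate\<close> has
  compensator rate \<open>1\<close>, so its expected total up to \<open>T\<close> is at most
  \<open>T\<close>. Since the exit rates are bounded by \<open>r\<close>, the expected number of
  jumps up to \<open>T\<close> is at most \<open>r * T\<close>.\<close>

lemma summable_prob_jump_time_le:
  assumes T: "0 \<le> T"
  shows "summable (\<lambda>n. prob {\<omega> \<in> space M. \<tau> (Suc n) \<omega> \<le> T})"
proof -
  define f where "f s s' = 1 / exit_rate S q s" for s s' :: 's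
  have "(\<Sum>s'\<in>S - {s}. q s s' * f s s') = 1" if "s \<in> S" for s
    using exit_pos[OF that] by (simp add: f_def exit_rate_def sum_divide_distrib[symmetric])
  then have dyn: "(\<Sum>n<m. expectation (\<lambda>\<omega>. indicator {..T} (\<tau> (Suc n) \<omega>) * f (Y n \<omega>) (Y (Suc n) \<omega>))) =
      1 * expectation (\<lambda>\<omega>. min (\<tau> m \<omega>) T)" for m
    by (rule dynkin[OF T])
  define r where "r = (\<Sum>s\<in>S. exit_rate S q s)"
  have r: "exit_rate S q s \<le> r" if "s \<in> S" for s
    unfolding r_def using that finite_S exit_pos by (intro member_le_sum) (auto intro: less_imp_le)
  have r0: "0 \<le> r" unfolding r_def using exit_pos by (intro sum_nonneg) (auto intro: less_imp_le)
  have le: "prob {\<omega> \<in> space M. \<tau> (Suc n) \<omega> \<le> T} \<le>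
      r * expectation (\<lambda>\<omega>. indicator {..T} (\<tau> (Suc n) \<omega>) * f (Y n \<omega>) (Y (Suc n) \<omega>))" for n
  proof -
    have "prob {\<omega> \<in> space M. \<tau> (Suc n) \<omega> \<le> T} = expectation (indicator {\<omega> \<in> space M. \<tau> (Suc n) \<omega> \<le> T})"
      by simp
    also have "\<dots> \<le> expectation (\<lambda>\<omega>. r * (indicator {..T} (\<tau> (Suc n) \<omega>) * f (Y n \<omega>) (Y (Suc n) \<omega>)))"
    proof (rule integral_mono)
      fix \<omega> assume \<omega>: "\<omega> \<in> space M"
      have "1 \<le> r * f (Y n \<omega>) (Y (Suc n) \<omega>)"
        using r[OF Y_in[OF \<omega>, of n]] exit_pos[OF Y_in[OF \<omega>, of n]] by (simp add: f_def)
      then show "indicator {\<omega> \<in> space M. \<tau> (Suc n) \<omega> \<le> T} \<omega> \<le> r * (indicator {..T} (\<tau> (Suc n) \<omega>) * f (Y n \<omega>) (Y (Suc n) \<omega>))"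
        by (auto simp: indicator_def)
    qed (auto intro!: integrable_mult_right jump_indicator_integrable integrable_real_indicator
      simp: emeasure_eq_measure)
    finally show ?thesis by simp
  qed
  show ?thesis
  proof (rule summableI_nonneg_bounded[rotated])
    fix m
    have "(\<Sum>n<m. prob {\<omega> \<in> space M. \<tau> (Suc n) \<omega> \<le> T}) \<le>
        (\<Sum>n<m. r * expectation (\<lambda>\<omega>. indicator {..T} (\<tau> (Suc n) \<omega>) * f (Y n \<omega>) (Y (Suc n) \<omega>)))"
      by (intro sum_mono le)
    also have "\<dots> = r * expectation (\<lambda>\<omega>. min (\<tau> m \<omega>) T)"
      unfolding sum_distrib_left[symmetric] dyn mult_1 ..
    also have "\<dots> \<le> r * expectation (\<lambda>\<omega>. T)"
      using integrable_min_jump_time[OF T] r0 by (intro mult_left_mono integral_mono) auto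
    finally show "(\<Sum>n<m. prob {\<omega> \<in> space M. \<tau> (Suc n) \<omega> \<le> T}) \<le> r * T"
      by (simp add: prob_space)
  qed simp
qed

text \<open>Jump times are nondecreasing, so the indicators are \<open>1\<close> on an initial
  segment of indices and \<open>0\<close> afterwards. This bounds the sum by the oscillation of
  \<open>h\<close>, uniformly in \<open>m\<close> and \<open>T\<close>.\<close>

lemma telescope_stopped:
  fixes h :: "'s \<Rightarrow> real"
  assumes \<omega>: "\<omega> \<in> space M"
  shows "\<exists>k. (\<Sum>n<m. indicator {..T} (\<tau> (Suc n) \<omega>) * (h (Y (Suc n) \<omega>) - h (Y n \<omega>))) = h (Y k \<omega>) - h (Y 0 \<omega>)"
proof (induction m)
  case 0 then show ?case by (intro exI[of _ 0]) simp
next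
  case (Suc m)
  show ?case
  proof (cases "\<tau> (Suc m) \<omega> \<le> T")
    case False
    then show ?thesis using Suc by simp
  next
    case True
    have "\<tau> (Suc n) \<omega> \<le> T" if "n \<le> m" for n
      using lift_Suc_mono_le[of "\<lambda>n. \<tau> n \<omega>" "Suc n" "Suc m"] jump_time_Suc_ge[of X _ \<omega>] that True by simp
    then have "(\<Sum>n<Suc m. indicator {..T} (\<tau> (Suc n) \<omega>) * (h (Y (Suc n) \<omega>) - h (Y n \<omega>))) =
        (\<Sum>n<Suc m. h (Y (Suc n) \<omega>) - h (Y n \<omega>))"
      by (intro sum.cong) auto
    also have "\<dots> = h (Y (Suc m) \<omega>) - h (Y 0 \<omega>)" by (rule sum_lessThan_telescope)
    finally show ?thesis by blast
  qed
qed

text \<open>The expected reward up to \<open>T\<close> differs from \<open>g * T\<close> only by the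
  expected increments of \<open>h\<close>, which telescope and stay below a constant
  \<open>C\<close> that does not depend on \<open>T\<close>. Dividing by \<open>T\<close> removes
  it.\<close>

theorem tendsto_average_reward:
  fixes R :: "'s \<Rightarrow> 's \<Rightarrow> real"
  assumes poisson: "\<And>s. s \<in> S \<Longrightarrow> (\<Sum>s'\<in>S - {s}. q s s' * (R s s' + h s' - h s)) = g"
  shows "((\<lambda>T. 1 / T * expectation (\<lambda>\<omega>. \<Sum>n\<in>{n. 1 \<le> n \<and> \<tau> n \<omega> \<le> T}.
    R (X (\<tau> (n - 1) \<omega>) \<omega>) (X (\<tau> n \<omega>) \<omega>))) \<longlongrightarrow> g) at_top"
proof -
  let ?I = "\<lambda>T n \<omega>. indicator {..T} (\<tau> (Suc n) \<omega>) :: real"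
  let ?G = "\<lambda>T \<omega>. \<Sum>n\<in>{n. 1 \<le> n \<and> \<tau> n \<omega> \<le> T}. R (X (\<tau> (n - 1) \<omega>) \<omega>) (X (\<tau> n \<omega>) \<omega>)"
  define C where "C = sum_abs (\<lambda>s s'. h s' - h s)"
  have main: "\<bar>expectation (?G T) - g * T\<bar> \<le> C" if T: "0 \<le> T" for T
  proof -
    let ?p = "\<lambda>n. prob {\<omega> \<in> space M. \<tau> (Suc n) \<omega> \<le> T}"
    let ?r = "\<lambda>n \<omega>. ?I T n \<omega> * R (Y n \<omega>) (Y (Suc n) \<omega>)"
    have sp: "summable ?p" by (rule summable_prob_jump_time_le[OF T])
    \<comment> \<open>Borel-Cantelli: almost surely only finitely many jumps occur up to
      \<open>T\<close>.\<close>
    have "AE \<omega> in M. eventually (\<lambda>n. \<omega> \<in> space M - {\<omega> \<in> space M. \<tau> (Suc n) \<omega> \<le> T}) sequentially"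
      by (rule borel_cantelli_AE1[OF _ _ sp]) (auto simp: emeasure_eq_measure)
    then have fin: "AE \<omega> in M. finite {n. \<tau> (Suc n) \<omega> \<le> T}"
    proof eventually_elim
      case (elim \<omega>)
      then obtain N where "\<And>n. N \<le> n \<Longrightarrow> \<not> \<tau> (Suc n) \<omega> \<le> T"
        by (auto simp: eventually_sequentially)
      then have "{n. \<tau> (Suc n) \<omega> \<le> T} \<subseteq> {..<N}" by (auto simp: not_le[symmetric])
      then show ?case by (rule finite_subset) simp
    qed
    have rp: "norm (expectation (\<lambda>\<omega>. norm (?r n \<omega>))) \<le> sum_abs R * ?p n" for n
    proof -
      have "expectation (\<lambda>\<omega>. norm (?r n \<omega>)) \<le> expectation (\<lambda>\<omega>. sum_abs R * indicator {\<omega> \<in> space M. \<tau> (Suc n) \<omega> \<le> T} \<omega>)"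
        using abs_le_sum_abs[of _ _ R] Y_in
        by (intro integral_mono integrable_norm jump_indicator_integrable integrable_mult_right
          integrable_real_indicator) (auto simp: indicator_def emeasure_eq_measure)
      then show ?thesis by (simp add: Bochner_Integration.integral_nonneg)
    qed
    have sums: "(\<lambda>n. expectation (?r n)) sums expectation (\<lambda>\<omega>. \<Sum>n. ?r n \<omega>)"
    proof (rule sums_integral)
      show "integrable M (?r n)" for n by (rule jump_indicator_integrable)
      show "AE \<omega> in M. summable (\<lambda>n. norm (?r n \<omega>))"
        using fin
      proof eventually_elim
        case (elim \<omega>)
        then show ?case by (rule summable_finite) (simp add: indicator_def)
      qed
      show "summable (\<lambda>n. expectation (\<lambda>\<omega>. norm (?r n \<omega>)))"
        by (rule summable_comparison_test[OF _ summable_mult[OF sp, of "sum_abs R"]]) (use rp in blast)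
    qed
    have [measurable]: "?r n \<in> borel_measurable M" for n by (rule jump_indicator_measurable)
    \<comment> \<open>A sum over an infinite index set is \<open>0\<close> by convention. The case
      distinction keeps the identity valid at every point, which is what measurability of
      \<open>?G T\<close> is read off from.\<close>
    have G: "?G T \<omega> = (if finite {n. \<tau> (Suc n) \<omega> \<le> T} then \<Sum>n. ?r n \<omega> else 0)" for \<omega>
    proof -
      have "{n. 1 \<le> n \<and> \<tau> n \<omega> \<le> T} = Suc ` {n. \<tau> (Suc n) \<omega> \<le> T}"
        by (auto simp: image_iff Suc_le_eq gr0_conv_Suc)
      then have "?G T \<omega> = (\<Sum>n\<in>{n. \<tau> (Suc n) \<omega> \<le> T}. R (Y n \<omega>) (Y (Suc n) \<omega>))"
        by (simp add: sum.reindex jump_chain_def)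
      also have "\<dots> = (if finite {n. \<tau> (Suc n) \<omega> \<le> T} then \<Sum>n. ?r n \<omega> else 0)"
        by (auto simp: indicator_def intro!: trans[OF _ suminf_finite[of "{n. \<tau> (Suc n) \<omega> \<le> T}", symmetric]])
      finally show ?thesis .
    qed
    have "expectation (?G T) = expectation (\<lambda>\<omega>. \<Sum>n. ?r n \<omega>)"
    proof (rule integral_cong_AE)
      have "finite {n. \<tau> (Suc n) \<omega> \<le> T} \<longleftrightarrow> (\<exists>N. \<forall>n. \<tau> (Suc n) \<omega> \<le> T \<longrightarrow> n < N)" for \<omega>
        by (simp add: finite_nat_set_iff_bounded)
      then have "Measurable.pred M (\<lambda>\<omega>. finite {n. \<tau> (Suc n) \<omega> \<le> T})" by simp
      then show "?G T \<in> borel_measurable M" unfolding G by measurable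
      show "AE \<omega> in M. ?G T \<omega> = (\<Sum>n. ?r n \<omega>)"
        using fin by eventually_elim (simp only: G if_True)
    qed measurable
    then have lim1: "(\<lambda>m. \<Sum>n<m. expectation (?r n)) \<longlonglongrightarrow> expectation (?G T)"
      using sums by (simp add: sums_def)
    \<comment> \<open>The minimum equals \<open>T\<close> unless the jump time is at most
      \<open>T\<close>, so the expectation falls short of \<open>T\<close> by at most
      \<open>T\<close> times a summable sequence.\<close>
    have lim2: "(\<lambda>m. expectation (\<lambda>\<omega>. min (\<tau> (Suc m) \<omega>) T)) \<longlonglongrightarrow> T"
    proof -
      have le: "norm (expectation (\<lambda>\<omega>. min (\<tau> (Suc m) \<omega>) T) - T) \<le> T * ?p m" for m
      proof -
        have "expectation (\<lambda>\<omega>. T - T * indicator {\<omega> \<in> space M. \<tau> (Suc m) \<omega> \<le> T} \<omega>) \<le> expectation (\<lambda>\<omega>. min (\<tau> (Suc m) \<omega>) T)"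
          using jump_time_nonneg[of X "Suc m"] T
          by (intro integral_mono integrable_min_jump_time Bochner_Integration.integrable_diff
            integrable_mult_right integrable_real_indicator) (auto simp: indicator_def emeasure_eq_measure)
        moreover have "expectation (\<lambda>\<omega>. min (\<tau> (Suc m) \<omega>) T) \<le> expectation (\<lambda>\<omega>. T)"
          using T by (intro integral_mono integrable_min_jump_time) auto
        moreover have "expectation (\<lambda>\<omega>. T - T * indicator {\<omega> \<in> space M. \<tau> (Suc m) \<omega> \<le> T} \<omega>) = T - T * ?p m"
          by (subst Bochner_Integration.integral_diff)
            (auto intro!: integrable_mult_right integrable_real_indicator simp: emeasure_eq_measure prob_space)
        ultimately show ?thesis by (simp add: prob_space)
      qed
      have "(\<lambda>m. T * ?p m) \<longlonglongrightarrow> 0"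
        by (rule tendsto_mult_right_zero[OF summable_LIMSEQ_zero[OF sp]])
      with always_eventually[OF allI[OF le]]
      have "(\<lambda>m. expectation (\<lambda>\<omega>. min (\<tau> (Suc m) \<omega>) T) - T) \<longlonglongrightarrow> 0"
        by (rule Lim_null_comparison)
      then show ?thesis by (rule LIM_zero_cancel)
    qed
    \<comment> \<open>Dynkin's formula for the reward plus the increment of \<open>h\<close>, after
      \<open>m\<close> jumps; the bound must be uniform in \<open>m\<close> to survive the
      limit.\<close>
    have bound: "\<bar>(\<Sum>n<m. expectation (?r n)) - g * expectation (\<lambda>\<omega>. min (\<tau> m \<omega>) T)\<bar> \<le> C" for m
    proof -
      let ?d = "\<lambda>n \<omega>. ?I T n \<omega> * (h (Y (Suc n) \<omega>) - h (Y n \<omega>))"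
      have int: "integrable M (?d n)" for n
        using jump_indicator_integrable[of T n "\<lambda>s s'. h s' - h s"] .
      have "g * expectation (\<lambda>\<omega>. min (\<tau> m \<omega>) T) =
          (\<Sum>n<m. expectation (\<lambda>\<omega>. ?I T n \<omega> * (R (Y n \<omega>) (Y (Suc n) \<omega>) + h (Y (Suc n) \<omega>) - h (Y n \<omega>))))"
        by (rule dynkin[OF T poisson, symmetric])
      also have "\<dots> = (\<Sum>n<m. expectation (?r n) + expectation (?d n))"
      proof (rule sum.cong[OF refl])
        fix n
        have "expectation (?r n) + expectation (?d n) = expectation (\<lambda>\<omega>. ?r n \<omega> + ?d n \<omega>)"
          by (rule Bochner_Integration.integral_add[OF jump_indicator_integrable int, symmetric])
        also have "\<dots> = expectation (\<lambda>\<omega>. ?I T n \<omega> * (R (Y n \<omega>) (Y (Suc n) \<omega>) + h (Y (Suc n) \<omega>) - h (Y n \<omega>)))"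
          by (intro Bochner_Integration.integral_cong refl) (simp add: algebra_simps)
        finally show "expectation (\<lambda>\<omega>. ?I T n \<omega> * (R (Y n \<omega>) (Y (Suc n) \<omega>) + h (Y (Suc n) \<omega>) - h (Y n \<omega>))) =
            expectation (?r n) + expectation (?d n)" ..
      qed
      also have "\<dots> = (\<Sum>n<m. expectation (?r n)) + expectation (\<lambda>\<omega>. \<Sum>n<m. ?d n \<omega>)"
        unfolding sum.distrib by (simp only: Bochner_Integration.integral_sum[OF int])
      finally have eq: "(\<Sum>n<m. expectation (?r n)) - g * expectation (\<lambda>\<omega>. min (\<tau> m \<omega>) T) =
        - expectation (\<lambda>\<omega>. \<Sum>n<m. ?d n \<omega>)" by simp
      have pt: "\<bar>\<Sum>n<m. ?d n \<omega>\<bar> \<le> C" if \<omega>: "\<omega> \<in> space M" for \<omega>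
      proof -
        obtain k where "(\<Sum>n<m. ?d n \<omega>) = h (Y k \<omega>) - h (Y 0 \<omega>)"
          using telescope_stopped[OF \<omega>] by blast
        then show ?thesis
          using abs_le_sum_abs[OF Y_in[OF \<omega>, of 0] Y_in[OF \<omega>, of k], of "\<lambda>s s'. h s' - h s"] by (simp add: C_def)
      qed
      have "\<bar>expectation (\<lambda>\<omega>. \<Sum>n<m. ?d n \<omega>)\<bar> \<le> expectation (\<lambda>\<omega>. \<bar>\<Sum>n<m. ?d n \<omega>\<bar>)"
        by (rule integral_abs_bound)
      also have "\<dots> \<le> expectation (\<lambda>\<omega>. C)"
        using pt by (intro integral_mono integrable_abs Bochner_Integration.integrable_sum int) auto
      finally show ?thesis unfolding eq by (simp add: prob_space)
    qed
    have "(\<lambda>m. \<bar>(\<Sum>n<Suc m. expectation (?r n)) - g * expectation (\<lambda>\<omega>. min (\<tau> (Suc m) \<omega>) T)\<bar>) \<longlonglongrightarrow>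
        \<bar>expectation (?G T) - g * T\<bar>"
      by (intro tendsto_intros lim2 LIMSEQ_Suc[OF lim1])
    then show ?thesis by (rule LIMSEQ_le_const2) (use bound in blast)
  qed
  have "((\<lambda>T. 1 / T * expectation (?G T) - g) \<longlongrightarrow> 0) at_top"
  proof (rule Lim_null_comparison)
    show "\<forall>\<^sub>F T in at_top. norm (1 / T * expectation (?G T) - g) \<le> C / T"
      using eventually_gt_at_top[of 0]
    proof eventually_elim
      case (elim T)
      then have "1 / T * expectation (?G T) - g = (expectation (?G T) - g * T) / T"
        by (simp add: field_simps)
      then show ?case using main[of T] elim by (simp add: abs_divide divide_right_mono)
    qed
    show "((\<lambda>T. C / T) \<longlongrightarrow> 0) at_top"
      by (rule tendsto_divide_0[OF tendsto_const filterlim_at_top_imp_at_infinity[OF filterlim_ident]])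
  qed
  then show ?thesis by (rule LIM_zero_cancel)
qed

end

section \<open>Tandem queues\<close>

text \<open>The left limit of a distribution function is the mass of \<open>{..<a}\<close>. This
  yields \<open>lam_pi \<le> lam\<close>, through which the load condition passes from
  \<open>lam\<close> to \<open>lam_pi\<close>.\<close>

lemma cdf_left_lim_nonneg:
  assumes "real_distribution D"
  shows "0 \<le> left_lim (cdf D) a"
proof -
  interpret real_distribution D by fact
  have "left_lim (cdf D) a = measure D {..<a}"
    unfolding left_lim_def by (intro tendsto_Lim cdf_at_left) (simp add: trivial_limit_at_left_real)
  then show ?thesis by simp
qed

text \<open>Treats the departure from the last station as one more service completion, so that all
  \<open>\<mu> j\<close> can enter one uniform sum.\<close>

definition serve :: "nat \<Rightarrow> nat \<Rightarrow> state \<Rightarrow> state" where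
  "serve J j s = (if j = J then depart J s else move j s)"

lemma tandem_rate_serve:
  assumes "1 \<le> J" "s \<in> tandem_states J B" "s' \<in> tandem_states J B"
  shows "tandem_rate J B lam \<mu> F \<pi> s s' =
    (if s' = arrive s then lam * (1 - left_lim F (\<pi> s)) else 0) +
    (\<Sum>j=1..J. if 0 < s j \<and> s' = serve J j s then \<mu> j else 0)"
proof -
  have "{1..J} = insert J {1..<J}" using assms(1) by auto
  then have "(\<Sum>j=1..J. if 0 < s j \<and> s' = serve J j s then \<mu> j else 0) =
      (if 0 < s J \<and> s' = depart J s then \<mu> J else 0) +
      (\<Sum>j=1..<J. if 0 < s j \<and> s' = serve J j s then \<mu> j else 0)"
    by (simp add: serve_def)
  also have "(\<Sum>j=1..<J. if 0 < s j \<and> s' = serve J j s then \<mu> j else 0) =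
      (\<Sum>j=1..<J. if 0 < s j \<and> s' = move j s then \<mu> j else 0)"
    by (intro sum.cong) (auto simp: serve_def)
  finally show ?thesis using assms by (simp add: tandem_rate_def)
qed

text \<open>Replaces summation over target states by summation over events. Lost customers and
  blocked servers are the events whose target lies outside the state space.\<close>

lemma sum_tandem_rate:
  fixes D :: "state \<Rightarrow> real"
  assumes J: "1 \<le> J" and s: "s \<in> tandem_states J B"
  shows "(\<Sum>s'\<in>tandem_states J B. tandem_rate J B lam \<mu> F \<pi> s s' * D s') =
    (if arrive s \<in> tandem_states J B then lam * (1 - left_lim F (\<pi> s)) * D (arrive s) else 0) +
    (\<Sum>j=1..J. if 0 < s j \<and> serve J j s \<in> tandem_states J B then \<mu> j * D (serve J j s) else 0)"
proof -
  let ?S = "tandem_states J B" and ?l = "lam * (1 - left_lim F (\<pi> s))"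
  note fin = finite_tandem_states[of J B]
  have "(\<Sum>s'\<in>?S. tandem_rate J B lam \<mu> F \<pi> s s' * D s') =
      (\<Sum>s'\<in>?S. (if s' = arrive s then ?l * D (arrive s) else 0) +
        (\<Sum>j=1..J. if s' = serve J j s then if 0 < s j then \<mu> j * D (serve J j s) else 0 else 0))"
    using J s by (intro sum.cong refl) (auto simp: tandem_rate_serve distrib_right sum_distrib_right intro!: sum.cong)
  also have "\<dots> = (\<Sum>s'\<in>?S. if s' = arrive s then ?l * D (arrive s) else 0) +
      (\<Sum>j=1..J. \<Sum>s'\<in>?S. if s' = serve J j s then if 0 < s j then \<mu> j * D (serve J j s) else 0 else 0)"
    by (simp only: sum.distrib sum.swap[of _ "{1..J}"])
  also have "(\<Sum>s'\<in>?S. if s' = arrive s then ?l * D (arrive s) else 0) =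
      (if arrive s \<in> ?S then ?l * D (arrive s) else 0)"
    using fin by (simp add: sum.delta)
  also have "(\<Sum>j=1..J. \<Sum>s'\<in>?S. if s' = serve J j s then if 0 < s j then \<mu> j * D (serve J j s) else 0 else 0) =
      (\<Sum>j=1..J. if 0 < s j \<and> serve J j s \<in> ?S then \<mu> j * D (serve J j s) else 0)"
    using fin by (intro sum.cong refl) (simp add: sum.delta)
  finally show ?thesis .
qed

lemma tandem_states_upd:
  "s \<in> tandem_states J B \<Longrightarrow> j \<in> {1..J} \<Longrightarrow> v \<le> B j + 1 \<Longrightarrow> s(j := v) \<in> tandem_states J B"
  by (auto simp: tandem_states_def PiE_iff extensional_def)

lemma tandem_states_le: "s \<in> tandem_states J B \<Longrightarrow> j \<in> {1..J} \<Longrightarrow> s j \<le> B j + 1"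
  unfolding tandem_states_def by (drule PiE_mem) auto

text \<open>The last nonempty station is never blocked.\<close>

lemma serve_possible:
  assumes s: "s \<in> tandem_states J B" and ne: "\<exists>j\<in>{1..J}. 0 < s j"
  shows "\<exists>j\<in>{1..J}. 0 < s j \<and> serve J j s \<in> tandem_states J B"
proof -
  define j where "j = Max {j\<in>{1..J}. 0 < s j}"
  have "j \<in> {j\<in>{1..J}. 0 < s j}" unfolding j_def using ne by (intro Max_in) auto
  then have j: "j \<in> {1..J}" "0 < s j" by auto
  have last: "s k = 0" if "j < k" "k \<le> J" for k
  proof (rule ccontr)
    assume "s k \<noteq> 0"
    then have "k \<le> j" unfolding j_def using that by (intro Max_ge) auto
    with that show False by simp
  qed
  have "s j - 1 \<le> B j + 1" using tandem_states_le[OF s j(1)] by linarith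
  then have upd: "s(j := s j - 1) \<in> tandem_states J B" by (rule tandem_states_upd[OF s j(1)])
  have "serve J j s \<in> tandem_states J B"
  proof (cases "j = J")
    case True
    then show ?thesis using upd by (simp add: serve_def depart_def)
  next
    case False
    then have "s(j := s j - 1, Suc j := s (Suc j) + 1) \<in> tandem_states J B"
      using j last[of "Suc j"] by (intro tandem_states_upd[OF upd]) auto
    then show ?thesis using False by (simp add: serve_def move_def)
  qed
  with j show ?thesis by blast
qed

text \<open>The mean total service time that the customers present still require.\<close>

definition workload :: "nat \<Rightarrow> (nat \<Rightarrow> real) \<Rightarrow> state \<Rightarrow> real" where
  "workload J \<mu> s = (\<Sum>j=1..J. (\<Sum>i=j..J. 1 / \<mu> i) * real (s j))"

lemma workload_upd:
  assumes "k \<in> {1..J}"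
  shows "workload J \<mu> (s(k := v)) = workload J \<mu> s + (\<Sum>i=k..J. 1 / \<mu> i) * (real v - real (s k))"
proof -
  have "workload J \<mu> t = (\<Sum>i=k..J. 1 / \<mu> i) * real (t k) + (\<Sum>j\<in>{1..J} - {k}. (\<Sum>i=j..J. 1 / \<mu> i) * real (t j))" for t
    unfolding workload_def using assms by (subst sum.remove[of _ k]) auto
  moreover have "(\<Sum>j\<in>{1..J} - {k}. (\<Sum>i=j..J. 1 / \<mu> i) * real ((s(k := v)) j)) =
      (\<Sum>j\<in>{1..J} - {k}. (\<Sum>i=j..J. 1 / \<mu> i) * real (s j))"
    by (intro sum.cong) auto
  ultimately show ?thesis by (simp add: algebra_simps)
qed

lemma workload_arrive: "1 \<le> J \<Longrightarrow> workload J \<mu> (arrive s) = workload J \<mu> s + (\<Sum>i=1..J. 1 / \<mu> i)"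
  unfolding arrive_def by (subst workload_upd) auto

text \<open>The weights of stations \<open>j\<close> and \<open>Suc j\<close> in
  \<open>workload\<close> differ by \<open>1 / \<mu> j\<close>, and the weight of the last station
  is \<open>1 / \<mu> J\<close>, so moving on and departing behave alike.\<close>

lemma workload_serve:
  assumes j: "j \<in> {1..J}" "0 < s j"
  shows "workload J \<mu> (serve J j s) = workload J \<mu> s - 1 / \<mu> j"
proof (cases "j = J")
  case True
  then show ?thesis using j by (simp add: serve_def depart_def workload_upd of_nat_diff)
next
  case False
  have "(\<Sum>i=j..J. 1 / \<mu> i) = 1 / \<mu> j + (\<Sum>i=Suc j..J. 1 / \<mu> i)"
    using j by (intro sum.atLeast_Suc_atMost) auto
  then show ?thesis
    using j False by (simp add: serve_def move_def workload_upd of_nat_diff algebra_simps)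
qed

section \<open>Exponential drift and the bound on the gain\<close>

text \<open>For each \<open>j\<close> the difference of the two sides without
  \<open>\<delta>\<close> vanishes at \<open>\<eta> = 0\<close> and has derivative
  \<open>1 - l * w > 0\<close> there, whatever \<open>\<mu> j\<close> is. As there are finitely many
  stations, one small \<open>\<eta>\<close> serves them all.\<close>

lemma exponential_drift_parameter:
  fixes \<mu> :: "nat \<Rightarrow> real"
  assumes \<mu>: "\<forall>j\<in>{1..J}. 0 < \<mu> j" and lw: "l * w < 1"
  shows "\<exists>\<eta>>0. \<exists>\<delta>>0. \<forall>j\<in>{1..J}. l * (exp (\<eta> * w) - 1) + \<delta> \<le> \<mu> j * (1 - exp (- \<eta> / \<mu> j))"
proof -
  define f where "f j \<eta> = \<mu> j * (1 - exp (- \<eta> / \<mu> j)) - l * (exp (\<eta> * w) - 1)" for j \<eta>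
  have "\<forall>\<^sub>F \<eta> in at_right 0. 0 < f j \<eta>" if j: "j \<in> {1..J}" for j
  proof -
    have "0 < \<mu> j" using \<mu> j by auto
    then have "(f j has_real_derivative 1 - l * w) (at 0)"
      unfolding f_def by (auto intro!: derivative_eq_intros)
    then obtain d where d: "0 < d" "\<And>\<eta>. 0 < \<eta> \<Longrightarrow> \<eta> < d \<Longrightarrow> f j 0 < f j (0 + \<eta>)"
      using DERIV_pos_inc_right[of "f j" "1 - l * w" 0] lw by auto
    then show ?thesis
      by (intro eventually_at_rightI[of 0 d]) (auto simp: f_def)
  qed
  then have "\<forall>\<^sub>F \<eta> in at_right 0. \<forall>j\<in>{1..J}. 0 < f j \<eta>"
    by (intro eventually_ball_finite) auto
  moreover have "\<forall>\<^sub>F \<eta> in at_right 0. (0::real) < \<eta>" by (rule eventually_at_right_less)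
  ultimately have "\<forall>\<^sub>F \<eta> in at_right 0. 0 < \<eta> \<and> (\<forall>j\<in>{1..J}. 0 < f j \<eta>)"
    by eventually_elim auto
  then obtain \<eta> where \<eta>: "0 < \<eta>" "\<forall>j\<in>{1..J}. 0 < f j \<eta>"
    using eventually_happens[of _ "at_right (0::real)"] by (auto simp: trivial_limit_at_right_real)
  \<comment> \<open>The inserted \<open>1\<close> keeps the set nonempty when
    \<open>J = 0\<close>.\<close>
  define \<delta> where "\<delta> = Min (insert 1 ((\<lambda>j. f j \<eta>) ` {1..J}))"
  have "0 < \<delta>" unfolding \<delta>_def using \<eta>(2) by (subst Min_gr_iff) auto
  moreover have "\<delta> \<le> f j \<eta>" if "j \<in> {1..J}" for j unfolding \<delta>_def using that by (intro Min_le) auto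
  ultimately show ?thesis using \<eta>(1) by (intro exI[of _ \<eta>] conjI exI[of _ \<delta>]) (auto simp: f_def algebra_simps)
qed

text \<open>An arrival multiplies \<open>\<Phi>\<close> by \<open>exp (\<eta> * w)\<close> and thus
  costs \<open>\<kappa> * \<Phi> s * K\<close>; each possible service completion brings at least
  \<open>\<kappa> * \<Phi> s * (K + \<delta>)\<close>. In a nonempty system one completion is
  possible and pays for the arrival with a surplus \<open>\<kappa> * \<delta> * \<Phi> s\<close>. In
  the empty system there is none; there \<open>\<Phi> s = 1\<close>, and the term
  \<open>\<kappa> * (K + \<delta>)\<close> makes up for it.\<close>

lemma tandem_drift:
  fixes J :: nat and B :: "nat \<Rightarrow> nat" and \<mu> :: "nat \<Rightarrow> real" and F :: "real \<Rightarrow> real"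
    and lam a \<eta> \<delta> \<kappa> :: real
  defines "w \<equiv> \<Sum>j=1..J. 1 / \<mu> j"
  defines "l \<equiv> lam * (1 - left_lim F a)"
  defines "K \<equiv> l * (exp (\<eta> * w) - 1)"
  defines "\<Phi> \<equiv> \<lambda>s. exp (\<eta> * workload J \<mu> s)"
  defines "R \<equiv> revenue (\<lambda>_. a)"
  defines "S \<equiv> tandem_states J B"
  assumes J: "1 \<le> J" and \<mu>: "\<forall>j\<in>{1..J}. 0 < \<mu> j" and l: "0 < l" and a: "0 \<le> a" and \<kappa>: "0 \<le> \<kappa>"
    and \<eta>: "0 < \<eta>" and \<delta>: "0 < \<delta>"
    and drift: "\<forall>j\<in>{1..J}. K + \<delta> \<le> \<mu> j * (1 - exp (- \<eta> / \<mu> j))"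
    and s: "s \<in> S"
  shows "(if arrive s \<in> S then l * a else 0) + \<kappa> * \<delta> * \<Phi> s - \<kappa> * (K + \<delta>) \<le>
    (\<Sum>s'\<in>S - {s}. tandem_rate J B lam \<mu> F (\<lambda>_. a) s s' * (R s s' + - \<kappa> * \<Phi> s' - - \<kappa> * \<Phi> s))"
proof -
  let ?q = "tandem_rate J B lam \<mu> F (\<lambda>_. a)"
  define D where "D s' = R s s' + - \<kappa> * \<Phi> s' - - \<kappa> * \<Phi> s" for s'
  have w: "0 \<le> w" unfolding w_def using \<mu> by (intro sum_nonneg) (auto intro: less_imp_le)
  have K: "0 \<le> K" unfolding K_def using l \<eta> w by (intro mult_nonneg_nonneg) auto
  have \<Phi>0: "0 < \<Phi> s" by (simp add: \<Phi>_def)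
  have ne: "arrive s \<noteq> s" by (auto simp: arrive_def fun_eq_iff)
  have "D s = 0" using ne by (simp add: D_def R_def revenue_def)
  then have sum: "(\<Sum>s'\<in>S - {s}. ?q s s' * D s') = (\<Sum>s'\<in>S. ?q s s' * D s')"
    using s finite_tandem_states[of J B] by (subst sum.remove[of S s]) (auto simp: S_def)
  also have "\<dots> = (if arrive s \<in> S then l * D (arrive s) else 0) +
      (\<Sum>j=1..J. if 0 < s j \<and> serve J j s \<in> S then \<mu> j * D (serve J j s) else 0)"
    unfolding S_def l_def using J s by (intro sum_tandem_rate) (simp_all add: S_def)
  finally have eq: "(\<Sum>s'\<in>S - {s}. ?q s s' * D s') = (if arrive s \<in> S then l * D (arrive s) else 0) +
      (\<Sum>j=1..J. if 0 < s j \<and> serve J j s \<in> S then \<mu> j * D (serve J j s) else 0)" .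
  have "D (arrive s) = a - \<kappa> * \<Phi> s * (exp (\<eta> * w) - 1)"
    using J by (simp add: D_def R_def revenue_def \<Phi>_def workload_arrive w_def distrib_left exp_add algebra_simps)
  then have arr: "l * D (arrive s) = l * a - \<kappa> * \<Phi> s * K"
    by (simp only: K_def) (simp add: algebra_simps)
  have srv: "\<kappa> * \<Phi> s * (\<mu> j * (1 - exp (- \<eta> / \<mu> j))) \<le> \<mu> j * D (serve J j s)"
    if j: "j \<in> {1..J}" "0 < s j" for j
  proof -
    have "\<Phi> (serve J j s) = \<Phi> s * exp (- \<eta> / \<mu> j)"
      using j by (simp add: \<Phi>_def workload_serve right_diff_distrib exp_add[symmetric])
    then have "\<kappa> * \<Phi> s * (1 - exp (- \<eta> / \<mu> j)) \<le> D (serve J j s)"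
      using a by (simp add: D_def R_def revenue_def algebra_simps)
    then have "\<mu> j * (\<kappa> * \<Phi> s * (1 - exp (- \<eta> / \<mu> j))) \<le> \<mu> j * D (serve J j s)"
      using \<mu> j by (intro mult_left_mono) (auto intro: less_imp_le)
    then show ?thesis by (simp add: mult_ac)
  qed
  have srv0: "0 \<le> \<mu> j * D (serve J j s)" and srv1: "\<kappa> * \<Phi> s * (K + \<delta>) \<le> \<mu> j * D (serve J j s)"
    if j: "j \<in> {1..J}" "0 < s j" for j
  proof -
    have "\<kappa> * \<Phi> s * (K + \<delta>) \<le> \<kappa> * \<Phi> s * (\<mu> j * (1 - exp (- \<eta> / \<mu> j)))"
      using drift j \<kappa> \<Phi>0 by (intro mult_left_mono) auto
    with srv[OF j] show "\<kappa> * \<Phi> s * (K + \<delta>) \<le> \<mu> j * D (serve J j s)" by linarith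
    moreover have "0 \<le> \<kappa> * \<Phi> s * (K + \<delta>)" using \<kappa> \<Phi>0 K \<delta> by simp
    ultimately show "0 \<le> \<mu> j * D (serve J j s)" by linarith
  qed
  have "(if arrive s \<in> S then l * a else 0) + \<kappa> * \<delta> * \<Phi> s - \<kappa> * (K + \<delta>) \<le>
      (\<Sum>s'\<in>S - {s}. ?q s s' * D s')"
  proof (cases "\<exists>j\<in>{1..J}. 0 < s j")
    case True
    then obtain j where j: "j \<in> {1..J}" "0 < s j" "serve J j s \<in> S"
      using serve_possible s unfolding S_def by blast
    have "\<mu> j * D (serve J j s) = (if 0 < s j \<and> serve J j s \<in> S then \<mu> j * D (serve J j s) else 0)"
      using j by simp
    also have "\<dots> \<le> (\<Sum>j=1..J. if 0 < s j \<and> serve J j s \<in> S then \<mu> j * D (serve J j s) else 0)"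
      using j(1) srv0 by (intro member_le_sum) auto
    finally have "\<kappa> * \<Phi> s * (K + \<delta>) \<le> (\<Sum>j=1..J. if 0 < s j \<and> serve J j s \<in> S then \<mu> j * D (serve J j s) else 0)"
      using srv1[OF j(1,2)] by linarith
    \<comment> \<open>The first bound is for a full station 1, where no arrival uses up the part
      \<open>\<kappa> * \<Phi> s * K\<close>; the second discards the correction term of the empty
      system.\<close>
    moreover have "0 \<le> \<kappa> * \<Phi> s * K" "0 \<le> \<kappa> * (K + \<delta>)" using \<kappa> \<Phi>0 K \<delta> by simp_all
    ultimately show ?thesis unfolding eq arr by (simp add: algebra_simps)
  next
    case False
    then have "workload J \<mu> s = 0" by (simp add: workload_def)
    then have "\<Phi> s = 1" by (simp add: \<Phi>_def)
    moreover have "arrive s \<in> S"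
      using s J False unfolding S_def arrive_def by (intro tandem_states_upd) auto
    moreover have "0 \<le> (\<Sum>j=1..J. if 0 < s j \<and> serve J j s \<in> S then \<mu> j * D (serve J j s) else 0)"
      using srv0 by (intro sum_nonneg) auto
    ultimately show ?thesis unfolding eq arr by (simp add: algebra_simps)
  qed
  then show ?thesis unfolding D_def .
qed

text \<open>The weight \<open>\<kappa>\<close> of the exponential is balanced between two demands:
  the surplus \<open>\<kappa> * \<delta> * \<Phi>\<close> has to cover \<open>l * a\<close> when
  station 1 is full, while \<open>\<kappa> * (K + \<delta>)\<close> is what is lost in the final
  bound.\<close>

lemma tandem_poisson_equation:
  fixes J :: nat and B :: "nat \<Rightarrow> nat" and \<mu> :: "nat \<Rightarrow> real" and F :: "real \<Rightarrow> real"
    and lam a \<eta> \<delta> :: real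
  defines "w \<equiv> \<Sum>j=1..J. 1 / \<mu> j"
  defines "l \<equiv> lam * (1 - left_lim F a)"
  defines "K \<equiv> l * (exp (\<eta> * w) - 1)"
  defines "R \<equiv> revenue (\<lambda>_. a)"
  defines "S \<equiv> tandem_states J B"
  defines "q \<equiv> tandem_rate J B lam \<mu> F (\<lambda>_. a)"
  assumes J: "1 \<le> J" and \<mu>: "\<forall>j\<in>{1..J}. 0 < \<mu> j" and l: "0 < l" and a: "0 \<le> a"
    and \<eta>: "0 < \<eta>" and \<delta>: "0 < \<delta>"
    and drift: "\<forall>j\<in>{1..J}. K + \<delta> \<le> \<mu> j * (1 - exp (- \<eta> / \<mu> j))"
  shows "\<exists>g h. (\<forall>s\<in>S. (\<Sum>s'\<in>S - {s}. q s s' * (R s s' + h s' - h s)) = g) \<and>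
    a * l * (1 - (K + \<delta>) / \<delta> * exp (- \<eta> * w) ^ (B 1 + 1)) \<le> g"
proof -
  define z :: state where "z = (\<lambda>j\<in>{1..J}. 0)"
  have z: "z \<in> S" by (auto simp: z_def S_def tandem_states_def)
  have fin: "finite S" unfolding S_def by (rule finite_tandem_states)
  have q: "0 \<le> q s s'" for s s' unfolding q_def using J \<mu> l by (intro tandem_rate_nonneg) (auto simp: l_def)
  have descent: "\<exists>s'\<in>S. 0 < q s s' \<and> workload J \<mu> s' < workload J \<mu> s" if s: "s \<in> S" "s \<noteq> z" for s
  proof -
    have "\<exists>j\<in>{1..J}. 0 < s j"
    proof (rule ccontr)
      assume "\<not> (\<exists>j\<in>{1..J}. 0 < s j)"
      then have "s = z" using s(1) by (auto simp: z_def S_def tandem_states_def PiE_iff extensional_def fun_eq_iff)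
      with s(2) show False ..
    qed
    then obtain j where j: "j \<in> {1..J}" "0 < s j" "serve J j s \<in> S"
      using serve_possible s(1) unfolding S_def by blast
    have \<mu>j: "0 < \<mu> j" using \<mu> j by auto
    have "0 < (\<Sum>i=1..J. if 0 < s i \<and> serve J j s = serve J i s then \<mu> i else 0)"
      using j \<mu> by (intro sum_pos2[of _ j]) (auto simp: less_imp_le)
    then have "0 < q s (serve J j s)"
      unfolding q_def using s(1) j(3) l J by (subst tandem_rate_serve) (auto simp: S_def l_def)
    moreover have "workload J \<mu> (serve J j s) < workload J \<mu> s"
      using j \<mu>j by (simp add: workload_serve)
    ultimately show ?thesis using j(3) by blast
  qed
  have "\<exists>g h. \<forall>s\<in>S. (\<Sum>s'\<in>S - {s}. q s s' * (R s s' + h s' - h s)) = g"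
    by (rule poisson_equation_solvable[OF fin z q descent])
  then obtain g h where gh: "\<forall>s\<in>S. (\<Sum>s'\<in>S - {s}. q s s' * (R s s' + h s' - h s)) = g"
    by (elim exE)
  \<comment> \<open>\<open>\<rho>\<close> is the reciprocal of
    \<open>exp (\<eta> * w * (B 1 + 1))\<close>, the least value that the exponential can take when
    station 1 holds \<open>B 1 + 1\<close> customers; \<open>\<kappa>\<close> is then the smallest
    weight for which this value is known to suffice.\<close>
  define \<rho> where "\<rho> = exp (- \<eta> * w) ^ (B 1 + 1)"
  define \<kappa> where "\<kappa> = l * a / \<delta> * \<rho>"
  have \<kappa>: "0 \<le> \<kappa>" using l a \<delta> by (simp add: \<kappa>_def \<rho>_def)
  have w: "0 \<le> w" unfolding w_def using \<mu> by (intro sum_nonneg) (auto intro: less_imp_le)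
  have "a * l * (1 - (K + \<delta>) / \<delta> * \<rho>) \<le> g"
  proof (rule poisson_equation_lower_bound[OF fin _ _ bspec[OF gh]])
    show "S \<noteq> {}" using z by auto
    fix s assume s: "s \<in> S"
    let ?\<Phi> = "\<lambda>s. exp (\<eta> * workload J \<mu> s)"
    \<comment> \<open>Either arrivals are possible and earn \<open>l * a\<close>, or station 1 is
      full and the surplus of the drift replaces them.\<close>
    have "l * a \<le> (if arrive s \<in> S then l * a else 0) + \<kappa> * \<delta> * ?\<Phi> s"
    proof (cases "arrive s \<in> S")
      case True
      then show ?thesis using \<kappa> \<delta> by simp
    next
      case False
      have "s 1 = B 1 + 1"
      proof (rule ccontr)
        assume "s 1 \<noteq> B 1 + 1"
        then have "s 1 + 1 \<le> B 1 + 1" using tandem_states_le[of s J B 1] s J by (auto simp: S_def)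
        then have "arrive s \<in> S" using s J unfolding S_def arrive_def by (intro tandem_states_upd) auto
        with False show False ..
      qed
      have "w * real (B 1 + 1) = (\<Sum>i=1..J. 1 / \<mu> i) * real (s 1)" unfolding w_def \<open>s 1 = B 1 + 1\<close> ..
      also have "\<dots> \<le> workload J \<mu> s"
        unfolding workload_def
        by (rule member_le_sum[of 1 "{1..J}" "\<lambda>j. (\<Sum>i=j..J. 1 / \<mu> i) * real (s j)"])
          (use J \<mu> in \<open>auto intro!: mult_nonneg_nonneg sum_nonneg simp: less_imp_le\<close>)
      finally have "exp (\<eta> * (w * real (B 1 + 1))) \<le> ?\<Phi> s" using \<eta> by simp
      moreover have "\<rho> * exp (\<eta> * (w * real (B 1 + 1))) = 1"
        by (simp add: \<rho>_def exp_of_nat_mult[symmetric] exp_add[symmetric] algebra_simps del: power_Suc)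
      moreover have "0 < \<rho>" by (simp add: \<rho>_def)
      ultimately have "1 \<le> \<rho> * ?\<Phi> s" by (metis mult_left_mono less_imp_le)
      then have "l * a * 1 \<le> l * a * (\<rho> * ?\<Phi> s)" using l a by (intro mult_left_mono) auto
      also have "\<dots> = \<kappa> * \<delta> * ?\<Phi> s" using \<delta> by (simp add: \<kappa>_def)
      finally show ?thesis using False by simp
    qed
    moreover have "(if arrive s \<in> S then l * a else 0) + \<kappa> * \<delta> * ?\<Phi> s - \<kappa> * (K + \<delta>) \<le>
        (\<Sum>s'\<in>S - {s}. q s s' * (R s s' + - \<kappa> * ?\<Phi> s' - - \<kappa> * ?\<Phi> s))"
      using drift l s unfolding q_def R_def S_def K_def l_def w_def
      by (intro tandem_drift) (use J \<mu> a \<kappa> \<eta> \<delta> in auto)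
    moreover have "a * l * (1 - (K + \<delta>) / \<delta> * \<rho>) = l * a - \<kappa> * (K + \<delta>)"
      using \<delta> by (simp add: \<kappa>_def field_simps)
    ultimately show "a * l * (1 - (K + \<delta>) / \<delta> * \<rho>) \<le>
        (\<Sum>s'\<in>S - {s}. q s s' * (R s s' + - \<kappa> * ?\<Phi> s' - - \<kappa> * ?\<Phi> s))"
      by linarith
  qed (rule q)
  with gh show ?thesis unfolding \<rho>_def by (intro exI conjI)
qed

text \<open>\<open>c\<close> and \<open>p\<close> are fixed before \<open>lam\<close>,
  \<open>F\<close>, the price and the buffers. This works because the arrival rate in the chain is
  \<open>lam * (1 - left_lim F a_pi)\<close>, which equals \<open>lam_pi\<close>, so
  \<open>\<eta>\<close>, \<open>\<delta>\<close> and \<open>K\<close> can be computed from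
  \<open>lam_pi\<close> and \<open>\<mu>\<close> alone.\<close>

theorem theorem1:
  fixes J :: nat and \<mu> :: "nat \<Rightarrow> real" and lam_pi :: real
  assumes "1 \<le> J" and "\<forall>j\<in>{1..J}. 0 < \<mu> j"
  shows "\<exists>c p :: real. 0 < c \<and> 0 < p \<and> p < 1 \<and>
    (\<forall>(lam :: real) (A :: real set) (F :: real \<Rightarrow> real) (a_pi :: real) (\<pi> :: state \<Rightarrow> real).
       0 < lam \<longrightarrow>
       A \<subseteq> {0..} \<longrightarrow>
       (\<exists>D. real_distribution D \<and> F = cdf D) \<longrightarrow>
       lam * (\<Sum>j=1..J. 1 / \<mu> j) < 1 \<longrightarrow>
       (\<forall>a\<in>A. 1 - left_lim F a > 0) \<longrightarrow>
       a_pi \<in> A \<longrightarrow>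
       \<pi> = (\<lambda>_. a_pi) \<longrightarrow>
       lam_pi = lam * (1 - left_lim F a_pi) \<longrightarrow>
       (\<forall>B :: nat \<Rightarrow> nat. \<forall>\<^sub>F B1 in sequentially.
          \<forall>(M :: 'w measure) X s0.
            s0 \<in> tandem_states J (B(1 := B1)) \<longrightarrow>
            ctmc M X (tandem_states J (B(1 := B1))) (tandem_rate J (B(1 := B1)) lam \<mu> F \<pi>) s0 \<longrightarrow>
            gain M X \<pi> \<ge> a_pi * lam * (1 - left_lim F a_pi) * (1 - c * p powi (int B1 - 1)) \<and>
            a_pi * lam * (1 - left_lim F a_pi) * (1 - c * p powi (int B1 - 1))
              = a_pi * lam_pi * (1 - c * p powi (int B1 - 1))))"
proof (cases "0 < lam_pi \<and> lam_pi * (\<Sum>j=1..J. 1 / \<mu> j) < 1")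
  \<comment> \<open>\<open>lam_pi\<close> is an arbitrary real at this point. Outside the stable
    range no admissible \<open>lam\<close>, \<open>F\<close> and price produce it, so any constants
    will do.\<close>
  case False
  have sum0: "0 \<le> (\<Sum>j=1..J. 1 / \<mu> j)"
    using assms by (intro sum_nonneg) (auto intro: less_imp_le)
  have absurd: False
    if "0 < lam" "\<exists>D. real_distribution D \<and> F = cdf D" "lam * (\<Sum>j=1..J. 1 / \<mu> j) < 1"
      "\<forall>a\<in>A. 1 - left_lim F a > 0" "a \<in> A" "lam_pi = lam * (1 - left_lim F a)"
    for lam :: real and A F a
  proof -
    have "0 < 1 - left_lim F a" "1 - left_lim F a \<le> 1"
      using that cdf_left_lim_nonneg by auto
    then have "0 < lam_pi" "lam_pi \<le> lam"
      using that(1,6) by (auto simp: mult_le_cancel_left2)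
    then show False
      using False that(3) sum0 mult_right_mono[of lam_pi lam "\<Sum>j=1..J. 1 / \<mu> j"] by linarith
  qed
  show ?thesis
    by (rule exI[of _ 1], rule exI[of _ "1/2"], intro conjI allI impI;
      (rule FalseE, rule absurd, assumption+ | simp))
next
  case True
  define w where "w = (\<Sum>j=1..J. 1 / \<mu> j)"
  obtain \<eta> \<delta> where \<eta>: "0 < \<eta>" and \<delta>: "0 < \<delta>"
    and drift: "\<forall>j\<in>{1..J}. lam_pi * (exp (\<eta> * w) - 1) + \<delta> \<le> \<mu> j * (1 - exp (- \<eta> / \<mu> j))"
    using exponential_drift_parameter[OF assms(2), of lam_pi w] True unfolding w_def by blast
  define K where "K = lam_pi * (exp (\<eta> * w) - 1)"
  define c where "c = (K + \<delta>) / \<delta>"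
  define p where "p = exp (- \<eta> * w)"
  have w: "0 < w" unfolding w_def using assms by (intro sum_pos) auto
  have "0 \<le> K" unfolding K_def using True \<eta> w by (intro mult_nonneg_nonneg) auto
  then have c: "0 < c" using \<delta> by (simp add: c_def)
  have p: "0 < p" "p < 1" using \<eta> w by (auto simp: p_def)
  have gain: "gain M X (\<lambda>_. a) \<ge> a * lam_pi * (1 - c * p powi (int B1 - 1))"
    if a: "0 \<le> a" and lp: "lam_pi = lam * (1 - left_lim F a)" and B1: "1 \<le> B1"
      and s0: "s0 \<in> tandem_states J (B(1 := B1))"
      and ctmc: "ctmc M X (tandem_states J (B(1 := B1))) (tandem_rate J (B(1 := B1)) lam \<mu> F (\<lambda>_. a)) s0"
    for lam F a B B1 and M :: "'w measure" and X s0
  proof -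
    let ?B = "B(1 := B1)"
    let ?S = "tandem_states J ?B" and ?q = "tandem_rate J ?B lam \<mu> F (\<lambda>_. a)" and ?R = "revenue (\<lambda>_. a)"
    have l: "0 < lam * (1 - left_lim F a)" using True lp by simp
    interpret finite_ctmc M X ?S ?q s0
      by (unfold_locales; (rule ctmc finite_tandem_states tandem_rate_nonneg[OF assms l]
        exit_rate_tandem_pos[OF assms l]; assumption?))
    obtain g h where gh: "\<forall>s\<in>?S. (\<Sum>s'\<in>?S - {s}. ?q s s' * (?R s s' + h s' - h s)) = g"
      and g: "a * lam_pi * (1 - c * p ^ (B1 + 1)) \<le> g"
      using tandem_poisson_equation[OF assms l a \<eta> \<delta>, of ?B] drift
      unfolding lp[symmetric] w_def[symmetric] K_def[symmetric] c_def p_def by auto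
    have "gain M X (\<lambda>_. a) = g"
      unfolding gain_def
      by (intro tendsto_Lim trivial_limit_at_top_linorder tendsto_average_reward[where h=h])
        (rule bspec[OF gh])
    moreover have "a * lam_pi * (1 - c * p powi (int B1 - 1)) \<le> a * lam_pi * (1 - c * p ^ (B1 + 1))"
    proof -
      \<comment> \<open>For \<open>1 \<le> B1\<close> the integer power is an ordinary one, and the
        bound with exponent \<open>B1 + 1\<close> is weakened to exponent
        \<open>B1 - 1\<close>.\<close>
      have "p powi (int B1 - 1) = p ^ (B1 - 1)"
        using B1 by (simp add: power_int_def nat_diff_distrib)
      moreover have "p ^ (B1 + 1) \<le> p ^ (B1 - 1)" using p by (intro power_decreasing) auto
      ultimately show ?thesis using a True c by (intro mult_left_mono) auto
    qed
    ultimately show ?thesis using g by linarith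
  qed
  show ?thesis
  proof (rule exI[of _ c], rule exI[of _ p], intro conjI c p allI impI)
    fix lam :: real and A :: "real set" and F :: "real \<Rightarrow> real" and a_pi :: real
      and \<pi> :: "state \<Rightarrow> real" and B :: "nat \<Rightarrow> nat"
    assume A: "A \<subseteq> {0..}" "a_pi \<in> A" and \<pi>: "\<pi> = (\<lambda>_. a_pi)"
      and lp: "lam_pi = lam * (1 - left_lim F a_pi)"
    have a: "0 \<le> a_pi" using A by auto
    have eq: "a_pi * lam * (1 - left_lim F a_pi) = a_pi * lam_pi" using lp by simp
    show "\<forall>\<^sub>F B1 in sequentially.
          \<forall>(M :: 'w measure) X s0.
            s0 \<in> tandem_states J (B(1 := B1)) \<longrightarrow>
            ctmc M X (tandem_states J (B(1 := B1))) (tandem_rate J (B(1 := B1)) lam \<mu> F \<pi>) s0 \<longrightarrow>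
            gain M X \<pi> \<ge> a_pi * lam * (1 - left_lim F a_pi) * (1 - c * p powi (int B1 - 1)) \<and>
            a_pi * lam * (1 - left_lim F a_pi) * (1 - c * p powi (int B1 - 1))
              = a_pi * lam_pi * (1 - c * p powi (int B1 - 1))"
      using eventually_ge_at_top[of 1]
    proof eventually_elim
      case (elim B1)
      show ?case
        unfolding \<pi> eq by (intro allI impI conjI refl gain[OF a lp elim])
    qed
  qed
qed

end
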